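(* The following results hold: 1. for every $j\in\{\mathtt{ad},\mathtt{st},\mathtt{co},\mathtt{gr}\}\times\{true,false\}$, the decision problem $j$-RELEVANCE is in $NP$; and 2. $\mathtt{pr}$-$true$-RELEVANCE and $\mathtt{pr}$-$false$-RELEVANCE are in $\Sigma_2^p$.
   Context: An argumentation framework (AF) is a pair $F=\langle \mathcal{A}_F,\mathcal{R}_F\rangle$ with $\mathcal{R}_F\subseteq\mathcal{A}_F\times\mathcal{A}_F$; $a$ attacks $b$ if $(a,b)\in\mathcal{R}_F$. For $S\subseteq\mathcal{A}_F$: $S_F^+$ is the set of arguments attacked by some element of $S$; $S$ is conflict-free iff $S\cap S_F^+=\emptyset$; $S$ defends $a$ if every attacker of $a$ is attacked by some element of $S$; $\Gamma_F(S)$ is the set of arguments of $F$ defended by $S$. Semantics, for $S\subseteq\mathcal{A}_F$: $S\in\mathtt{ad}(F)$ (admissible) iff $S$ is conflict-free and $S\subseteq\Gamma_F(S)$; $S\in\mathtt{st}(F)$ (stable) iff $S$ is conflict-free and $S_F^+=\mathcal{A}_F\setminus S$; $S\in\mathtt{co}(F)$ (complete) iff $S\in\mathtt{ad}(F)$ and $\Gamma_F(S)\subseteq S$; $S\in\mathtt{gr}(F)$ (grounded) iff $S$ is $\subseteq$-minimal in $\mathtt{co}(F)$; $S\in\mathtt{pr}(F)$ (preferred) iff $S$ is $\subseteq$-maximal in $\mathtt{ad}(F)$. A set $S$ is $\sigma$-$true$ in $F$ iff $S\in\sigma(F)$, and $\sigma$-$false$ in $F$ iff $S\notin\sigma(F)$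 (in particular if $S\not\subseteq\mathcal{A}_F$). An incomplete argumentation framework (IAF) is $I=\langle\mathcal{A},\mathcal{A}^?,\mathcal{R},\mathcal{R}^?\rangle$ with $\mathcal{A},\mathcal{A}^?$ disjoint sets of (certain, uncertain) arguments and $\mathcal{R},\mathcal{R}^?$ disjoint subsets of $(\mathcal{A}\cup\mathcal{A}^?)\times(\mathcal{A}\cup\mathcal{A}^?)$ (certain, uncertain attacks). A partial completion of $I$ is an IAF $I'=\langle\mathcal{A}',\mathcal{A}^{?'},\mathcal{R}',\mathcal{R}^{?'}\rangle$ with $\mathcal{A}\subseteq\mathcal{A}'\subseteq\mathcal{A}\cup\mathcal{A}^?$, $\mathcal{R}\cap((\mathcal{A}'\cup\mathcal{A}^{?'})\times(\mathcal{A}'\cup\mathcal{A}^{?'}))\subseteq\mathcal{R}'\subseteq\mathcal{R}\cup\mathcal{R}^?$, $\mathcal{A}^{?'}\subseteq\mathcal{A}^?$, $\mathcal{R}^{?'}\subseteq\mathcal{R}^?$; $part(I)$ is the set of partial completions. $cert(I)=\langle\mathcal{A},\mathcal{R}\cap(\mathcal{A}\times\mathcal{A})\rangle$. For $\mathcal{R}_0\subseteq\mathcal{R}^?$: $I+\mathcal{R}_0=\langle\mathcal{A},\mathcal{A}^?,\mathcal{R}\cup\mathcal{R}_0,\mathcal{R}^?\setminus\mathcal{R}_0\rangle$, $I-\mathcal{R}_0=\langle\mathcal{A},\mathcal{A}^?,\mathcal{R},\mathcal{R}^?\setminus\mathcal{R}_0\rangle$. For $\mathcal{A}_0\subseteq\mathcal{A}^?$: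 $I+\mathcal{A}_0=\langle\mathcal{A}\cup\mathcal{A}_0,\mathcal{A}^?\setminus\mathcal{A}_0,\mathcal{R},\mathcal{R}^?\rangle$, and $I-\mathcal{A}_0=\langle\mathcal{A},\mathcal{A}^?\setminus\mathcal{A}_0,\mathcal{R}\setminus\mathcal{R}'',\mathcal{R}^?\setminus\mathcal{R}''\rangle$ where $\mathcal{R}''$ is the set of attacks in $\mathcal{R}\cup\mathcal{R}^?$ having an endpoint in $\mathcal{A}_0$. Relevance: for $S\subseteq\mathcal{A}\cup\mathcal{A}^?$, a verification status $j$ and $e\in\mathcal{A}^?\cup\mathcal{R}^?$, addition (resp. removal) of $e$ is $j$-relevant for $S$ w.r.t. $I$ iff there is $I'=\langle\mathcal{A}',\mathcal{A}^{?'},\mathcal{R}',\mathcal{R}^{?'}\rangle\in part(I)$ with $\mathcal{A}^{?'}\cup\mathcal{R}^{?'}=\{e\}$ such that $S$ is $j$ in $cert(I'+\{e\})$ (resp. $cert(I'-\{e\})$) while $S$ is not $j$ in $cert(I'-\{e\})$ (resp. $cert(I'+\{e\})$). Problem $j$-RELEVANCE. Given: an IAF $I=\langle\mathcal{A},\mathcal{A}^?,\mathcal{R},\mathcal{R}^?\rangle$, a set $S\subseteq\mathcal{A}\cup\mathcal{A}^?$, an action in $\{\text{addition},\text{removal}\}$ and an uncertain element $e\in\mathcal{A}^?\cup\mathcal{R}^?$. Question: is the action on $e$ $j$-relevant for $S$ w.r.t. $I$? *)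

theory Defs
  imports Complex_Main "HOL-Computational_Algebra.Polynomial"
begin

section \<open>Argumentation frameworks\<close>

record 'a af =
  args :: "'a set"
  atts :: "('a \<times> 'a) set"

definition attacked_by :: "'a af \<Rightarrow> 'a set \<Rightarrow> 'a set" where
  "attacked_by F S = {b. \<exists>a\<in>S. (a, b) \<in> atts F}"

definition conflict_free :: "'a af \<Rightarrow> 'a set \<Rightarrow> bool" where
  "conflict_free F S \<longleftrightarrow> S \<inter> attacked_by F S = {}"

definition defends :: "'a af \<Rightarrow> 'a set \<Rightarrow> 'a \<Rightarrow> bool" where
  "defends F S a \<longleftrightarrow> (\<forall>b. (b, a) \<in> atts F \<longrightarrow> (\<exists>c\<in>S. (c, b) \<in> atts F))"

definition Gamma :: "'a af \<Rightarrow> 'a set \<Rightarrow> 'a set" where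
  "Gamma F S = {a \<in> args F. defends F S a}"

definition admissible :: "'a af \<Rightarrow> 'a set set" where
  "admissible F = {S. S \<subseteq> args F \<and> conflict_free F S \<and> S \<subseteq> Gamma F S}"

definition stable :: "'a af \<Rightarrow> 'a set set" where
  "stable F = {S. S \<subseteq> args F \<and> conflict_free F S \<and> attacked_by F S = args F - S}"

definition complete_ext :: "'a af \<Rightarrow> 'a set set" where
  "complete_ext F = {S. S \<in> admissible F \<and> Gamma F S \<subseteq> S}"

definition grounded :: "'a af \<Rightarrow> 'a set set" where
  "grounded F = {S. S \<in> complete_ext F \<and> \<not> (\<exists>T\<in>complete_ext F. T \<subset> S)}"

definition preferred :: "'a af \<Rightarrow> 'a set set" where
  "preferred F = {S. S \<in> admissible F \<and> \<not> (\<exists>T\<in>admissible F. S \<subset> T)}"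

datatype semantics = AD | ST | CO | GR | PR

fun extensions :: "semantics \<Rightarrow> 'a af \<Rightarrow> 'a set set" where
  "extensions AD F = admissible F"
| "extensions ST F = stable F"
| "extensions CO F = complete_ext F"
| "extensions GR F = grounded F"
| "extensions PR F = preferred F"

text \<open>A verification status pairs a semantics with True (the set is an extension)
  or False (it is not).\<close>

type_synonym status = "semantics \<times> bool"

definition has_status :: "status \<Rightarrow> 'a af \<Rightarrow> 'a set \<Rightarrow> bool" where
  "has_status j F S \<longleftrightarrow> (S \<in> extensions (fst j) F) = snd j"


section \<open>Incomplete argumentation frameworks\<close>

record 'a iaf =
  cert_args :: "'a set"
  unc_args :: "'a set"
  cert_atts :: "('a \<times> 'a) set"
  unc_atts :: "('a \<times> 'a) set"

definition is_iaf :: "'a iaf \<Rightarrow> bool" where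
  "is_iaf I \<longleftrightarrow>
     cert_args I \<inter> unc_args I = {} \<and>
     cert_atts I \<inter> unc_atts I = {} \<and>
     cert_atts I \<subseteq> (cert_args I \<union> unc_args I) \<times> (cert_args I \<union> unc_args I) \<and>
     unc_atts I \<subseteq> (cert_args I \<union> unc_args I) \<times> (cert_args I \<union> unc_args I)"

definition part :: "'a iaf \<Rightarrow> 'a iaf set" where
  "part I = {I'. is_iaf I' \<and>
     cert_args I \<subseteq> cert_args I' \<and> cert_args I' \<subseteq> cert_args I \<union> unc_args I \<and>
     cert_atts I \<inter> ((cert_args I' \<union> unc_args I') \<times> (cert_args I' \<union> unc_args I'))
       \<subseteq> cert_atts I' \<and>
     cert_atts I' \<subseteq> cert_atts I \<union> unc_atts I \<and>
     unc_args I' \<subseteq> unc_args I \<and>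
     unc_atts I' \<subseteq> unc_atts I}"

definition cert :: "'a iaf \<Rightarrow> 'a af" where
  "cert I = \<lparr>args = cert_args I, atts = cert_atts I \<inter> (cert_args I \<times> cert_args I)\<rparr>"

definition add_atts :: "'a iaf \<Rightarrow> ('a \<times> 'a) set \<Rightarrow> 'a iaf" where
  "add_atts I R0 = \<lparr>cert_args = cert_args I, unc_args = unc_args I,
     cert_atts = cert_atts I \<union> R0, unc_atts = unc_atts I - R0\<rparr>"

definition remove_atts :: "'a iaf \<Rightarrow> ('a \<times> 'a) set \<Rightarrow> 'a iaf" where
  "remove_atts I R0 = \<lparr>cert_args = cert_args I, unc_args = unc_args I,
     cert_atts = cert_atts I, unc_atts = unc_atts I - R0\<rparr>"

definition add_args :: "'a iaf \<Rightarrow> 'a set \<Rightarrow> 'a iaf" where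
  "add_args I A0 = \<lparr>cert_args = cert_args I \<union> A0, unc_args = unc_args I - A0,
     cert_atts = cert_atts I, unc_atts = unc_atts I\<rparr>"

definition remove_args :: "'a iaf \<Rightarrow> 'a set \<Rightarrow> 'a iaf" where
  "remove_args I A0 =
     (let R'' = {(a, b). (a, b) \<in> cert_atts I \<union> unc_atts I \<and> (a \<in> A0 \<or> b \<in> A0)}
      in \<lparr>cert_args = cert_args I, unc_args = unc_args I - A0,
          cert_atts = cert_atts I - R'', unc_atts = unc_atts I - R''\<rparr>)"

text \<open>An uncertain element is an argument (left summand) or an attack (right summand);
  the set of uncertain elements is the disjoint sum of the two sets.\<close>

type_synonym 'a element = "'a + 'a \<times> 'a"

definition uncertain :: "'a iaf \<Rightarrow> 'a element set" where
  "uncertain I = unc_args I <+> unc_atts I"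

fun add_element :: "'a iaf \<Rightarrow> 'a element \<Rightarrow> 'a iaf" where
  "add_element I (Inl a) = add_args I {a}"
| "add_element I (Inr r) = add_atts I {r}"

fun remove_element :: "'a iaf \<Rightarrow> 'a element \<Rightarrow> 'a iaf" where
  "remove_element I (Inl a) = remove_args I {a}"
| "remove_element I (Inr r) = remove_atts I {r}"

datatype action = Addition | Removal

fun perform :: "action \<Rightarrow> 'a iaf \<Rightarrow> 'a element \<Rightarrow> 'a iaf" where
  "perform Addition I e = add_element I e"
| "perform Removal I e = remove_element I e"

fun opposite :: "action \<Rightarrow> action" where
  "opposite Addition = Removal"
| "opposite Removal = Addition"

definition relevant :: "status \<Rightarrow> action \<Rightarrow> 'a element \<Rightarrow> 'a set \<Rightarrow> 'a iaf \<Rightarrow> bool" where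
  "relevant j act e S I \<longleftrightarrow>
     (\<exists>I'\<in>part I. uncertain I' = {e} \<and>
        has_status j (cert (perform act I' e)) S \<and>
        \<not> has_status j (cert (perform (opposite act) I' e)) S)"


section \<open>Turing machines and complexity classes\<close>

text \<open>Deterministic multi-tape machines with two-way infinite tapes. States are the
  naturals below \<open>num_states\<close>, tape symbols those below \<open>num_syms\<close>; symbol 0 is the blank,
  1 and 2 represent the bits False and True.\<close>

datatype direction = Move_Left | Stay | Move_Right

record tm =
  num_tapes :: nat
  num_states :: nat
  num_syms :: nat
  start :: nat
  acc :: nat
  rej :: nat
  trans :: "nat \<Rightarrow> nat list \<Rightarrow> nat \<times> (nat \<times> direction) list"

definition is_tm :: "tm \<Rightarrow> bool" where
  "is_tm M \<longleftrightarrow>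
     3 \<le> num_syms M \<and> start M < num_states M \<and>
     acc M < num_states M \<and> rej M < num_states M \<and> acc M \<noteq> rej M \<and>
     (\<forall>q < num_states M. \<forall>ss. length ss = num_tapes M \<and> set ss \<subseteq> {..<num_syms M} \<longrightarrow>
        fst (trans M q ss) < num_states M \<and>
        length (snd (trans M q ss)) = num_tapes M \<and>
        fst ` set (snd (trans M q ss)) \<subseteq> {..<num_syms M})"

text \<open>A tape is its contents together with its head position.\<close>

type_synonym tape = "(int \<Rightarrow> nat) \<times> int"
type_synonym config = "nat \<times> tape list"

fun read_tape :: "tape \<Rightarrow> nat" where
  "read_tape (t, h) = t h"

fun offset :: "direction \<Rightarrow> int" where
  "offset Move_Left = -1"
| "offset Stay = 0"
| "offset Move_Right = 1"

fun act_tape :: "tape \<Rightarrow> nat \<times> direction \<Rightarrow> tape" where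
  "act_tape (t, h) (s, d) = (t(h := s), h + offset d)"

fun step :: "tm \<Rightarrow> config \<Rightarrow> config" where
  "step M (q, ts) =
     (if q = acc M \<or> q = rej M then (q, ts)
      else (case trans M q (map read_tape ts) of (q', as) \<Rightarrow> (q', map2 act_tape ts as)))"

definition input_tape :: "bool list \<Rightarrow> tape" where
  "input_tape w =
     (\<lambda>i. if 0 \<le> i \<and> i < int (length w) then (if w ! nat i then 2 else 1) else 0, 0)"

text \<open>Several input words are supplied on separate tapes, which replaces an encoding of
  tuples as words; the remaining tapes are blank.\<close>

definition initial :: "tm \<Rightarrow> bool list list \<Rightarrow> config" where
  "initial M ws =
     (start M, map input_tape ws @ replicate (num_tapes M - length ws) (input_tape []))"

definition poly_time_decidable :: "nat \<Rightarrow> (bool list list \<Rightarrow> bool) \<Rightarrow> bool" where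
  "poly_time_decidable m P \<longleftrightarrow>
     (\<exists>M (p :: nat poly). is_tm M \<and> m \<le> num_tapes M \<and>
        (\<forall>ws. length ws = m \<longrightarrow>
           (\<exists>t \<le> poly p (sum_list (map length ws)).
              fst ((step M ^^ t) (initial M ws)) = (if P ws then acc M else rej M))))"

definition NP :: "bool list set set" where
  "NP = {L. \<exists>P (p :: nat poly). poly_time_decidable 2 P \<and>
     (\<forall>x. x \<in> L \<longleftrightarrow> (\<exists>u. length u \<le> poly p (length x) \<and> P [x, u]))}"

definition Sigma2P :: "bool list set set" where
  "Sigma2P = {L. \<exists>P (p :: nat poly). poly_time_decidable 3 P \<and>
     (\<forall>x. x \<in> L \<longleftrightarrow>
        (\<exists>u. length u \<le> poly p (length x) \<and>
          (\<forall>v. length v \<le> poly p (length x) \<longrightarrow> P [x, u, v])))}"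


section \<open>The decision problem\<close>

text \<open>The word for an instance is built from an enumeration \<open>xs\<close> of all arguments: their
  number in unary, the action, characteristic vectors of the certain arguments, of \<open>S\<close> and
  of \<open>e\<close> (if it is an argument), and adjacency matrices, row by row, of the certain attacks,
  of the uncertain attacks and of \<open>e\<close> (if it is an attack). A word determines the instance
  up to renaming of arguments, so taking arguments from \<open>nat\<close> and allowing
  every enumeration loses no finite instance and merges no two non-isomorphic ones.\<close>

definition encode ::
  "'a list \<Rightarrow> 'a iaf \<Rightarrow> 'a set \<Rightarrow> action \<Rightarrow> 'a element \<Rightarrow> bool list" where
  "encode xs I S act e =
     replicate (length xs) True @ [False] @ [act = Addition] @
     map (\<lambda>a. a \<in> cert_args I) xs @
     map (\<lambda>a. a \<in> S) xs @
     map (\<lambda>a. e = Inl a) xs @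
     map (\<lambda>r. r \<in> cert_atts I) (List.product xs xs) @
     map (\<lambda>r. r \<in> unc_atts I) (List.product xs xs) @
     map (\<lambda>r. e = Inr r) (List.product xs xs)"

definition RELEVANCE :: "status \<Rightarrow> bool list set" where
  "RELEVANCE j = {encode xs I S act e | (xs :: nat list) I S act e.
     is_iaf I \<and> distinct xs \<and> set xs = cert_args I \<union> unc_args I \<and>
     S \<subseteq> cert_args I \<union> unc_args I \<and> e \<in> uncertain I \<and>
     relevant j act e S I}"

end

(* Relevance for ad, st, co and gr is definable by an existential second-order sentence over the
   arguments of the instance: guess the completion and check by a first-order formula that the set
   is an extension on one side and is not one on the other. For gr, membership is certified by a
   strict partial order in which every attacker of an element of the set is attacked by a smaller
   element of the set, and non-membership by a smaller complete set. For pr, maximality needs a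
   universally quantified set in addition, which gives Sigma_2. The verifier evaluates a fixed
   first-order formula by nested loops over the universe, on a machine that keeps its variables as
   unary numbers on separate tapes. *)

theory Submission
  imports Defs
begin

section \<open>Programs on unary registers and their compilation to Turing machines\<close>

text \<open>The complexity classes are defined by concrete machines, so the polynomial bound has to
  come from an actual program. Storing numbers in unary makes an increment a constant number of
  moves, and treating the head position of an input tape as one more register reduces random access
  to counting up to the address and back. A second obstacle is that the language consists of words,
  not of instances: the verifier must reject every word that encodes nothing. The size of the
  universe is therefore taken from the leading ones of the word, and the formula also tests the
  length of the word and the conditions on its blocks. Certificates need no such test, because every
  word can be read as some tuple of sets. Minimality in the grounded case quantifies universally
  over sets, which an existential guess cannot express; the guessed order replaces the stages at
  which arguments enter the iteration of \<open>Gamma\<close> from the empty set.\<close>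

datatype com =
    Skip
  | Inc nat
  | Dec nat
  | Seq com com (infixr ";;" 60)
  | Cond nat nat com com
  | While nat nat com

text \<open>For a register, cell 0 stays blank and the head stands on the last of the
  \<open>v\<close> marks, so the symbol under the head is the zero test. An input tape keeps its
  contents and its value is the head position.\<close>

definition tape_at :: "bool list list \<Rightarrow> nat \<Rightarrow> nat \<Rightarrow> tape" where
  "tape_at ws k v =
     (if k < length ws then fst (input_tape (ws ! k)) else (\<lambda>x. if 0 < x \<and> x \<le> int v then 1 else 0),
      int v)"

definition sym :: "bool list list \<Rightarrow> nat \<Rightarrow> nat \<Rightarrow> nat" where
  "sym ws k v = read_tape (tape_at ws k v)"

text \<open>The time counts steps of the compiled code exactly: incrementing a register takes two,
  since a machine step writes before it moves, and the first branch of a conditional pays for a jump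
  over the second. No rule decrements zero, so a derivation guarantees that no head passes to the
  left of cell 0.\<close>

inductive exec :: "bool list list \<Rightarrow> com \<Rightarrow> (nat \<Rightarrow> nat) \<Rightarrow> nat \<Rightarrow> (nat \<Rightarrow> nat) \<Rightarrow> bool"
  for ws where
  exec_Skip: "exec ws Skip s 0 s"
| exec_Inc: "exec ws (Inc k) s (if k < length ws then 1 else 2) (s(k := Suc (s k)))"
| exec_Dec: "s k = Suc v \<Longrightarrow> exec ws (Dec k) s 1 (s(k := v))"
| exec_Seq: "exec ws a s t s' \<Longrightarrow> exec ws b s' t' s'' \<Longrightarrow> exec ws (a ;; b) s (t + t') s''"
| exec_CondT: "sym ws k (s k) = x \<Longrightarrow> exec ws a s t s' \<Longrightarrow> exec ws (Cond k x a b) s (Suc (t + 1)) s'"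
| exec_CondF: "sym ws k (s k) \<noteq> x \<Longrightarrow> exec ws b s t s' \<Longrightarrow> exec ws (Cond k x a b) s (Suc t) s'"
| exec_WhileF: "sym ws k (s k) \<noteq> x \<Longrightarrow> exec ws (While k x a) s 1 s"
| exec_WhileT: "sym ws k (s k) = x \<Longrightarrow> exec ws a s t s' \<Longrightarrow> exec ws (While k x a) s' t' s'' \<Longrightarrow>
     exec ws (While k x a) s (Suc (t + Suc t')) s''"

datatype instr = Act nat "nat option" direction | Branch nat nat nat nat

fun com_size :: "nat \<Rightarrow> com \<Rightarrow> nat" where
  "com_size m Skip = 0"
| "com_size m (Inc k) = (if k < m then 1 else 2)"
| "com_size m (Dec k) = 1"
| "com_size m (a ;; b) = com_size m a + com_size m b"
| "com_size m (Cond k x a b) = com_size m a + com_size m b + 2"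
| "com_size m (While k x a) = com_size m a + 2"

text \<open>Jump targets are absolute, hence the start address \<open>q\<close>. A
  \<open>Branch\<close> with two equal targets is an unconditional jump.\<close>

fun compile :: "nat \<Rightarrow> com \<Rightarrow> nat \<Rightarrow> instr list" where
  "compile m Skip q = []"
| "compile m (Inc k) q =
     (if k < m then [Act k None Move_Right]
      else [Act k None Move_Right, Act k (Some 1) Stay])"
| "compile m (Dec k) q = [Act k (if k < m then None else Some 0) Move_Left]"
| "compile m (a ;; b) q = compile m a q @ compile m b (q + com_size m a)"
| "compile m (Cond k x a b) q =
     (let q' = Suc (q + com_size m a); end = Suc (q' + com_size m b)
      in Branch k x (Suc q) (Suc q') # compile m a (Suc q) @ Branch k x end end #
         compile m b (Suc q'))"
| "compile m (While k x a) q =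
     (let q' = Suc (q + com_size m a)
      in Branch k x (Suc q) (Suc q') # compile m a (Suc q) @ [Branch k x q q])"

lemma length_compile [simp]: "length (compile m c q) = com_size m c"
  by (induction c arbitrary: q) (auto simp: Let_def)

fun tapes_used :: "com \<Rightarrow> nat set" where
  "tapes_used Skip = {}"
| "tapes_used (Inc k) = {k}"
| "tapes_used (Dec k) = {k}"
| "tapes_used (a ;; b) = tapes_used a \<union> tapes_used b"
| "tapes_used (Cond k x a b) = {k} \<union> tapes_used a \<union> tapes_used b"
| "tapes_used (While k x a) = {k} \<union> tapes_used a"

lemma finite_tapes_used: "finite (tapes_used c)"
  by (induction c) auto

fun ok_instr :: "nat \<Rightarrow> instr \<Rightarrow> bool" where
  "ok_instr n (Act k w d) \<longleftrightarrow> (\<forall>y. w = Some y \<longrightarrow> y < 3)"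
| "ok_instr n (Branch k x q1 q2) \<longleftrightarrow> q1 < n \<and> q2 < n"

lemma ok_instr_compile: "i \<in> set (compile m c q) \<Longrightarrow> q + com_size m c < n \<Longrightarrow> ok_instr n i"
  by (induction c arbitrary: q) (fastforce simp: Let_def split: if_splits)+

text \<open>The state is the program counter, and the two states just past the code accept and
  reject. The last case only makes the transition function total.\<close>

definition machine :: "nat \<Rightarrow> instr list \<Rightarrow> tm" where
  "machine n code =
     \<lparr>num_tapes = n, num_states = length code + 2, num_syms = 3, start = 0,
      acc = length code, rej = Suc (length code),
      trans = \<lambda>q xs.
        if q < length code then
          (case code ! q of
             Act k w d \<Rightarrow>
               (Suc q, map (\<lambda>i. if i = k then (case w of None \<Rightarrow> xs ! i | Some y \<Rightarrow> y, d)
                                else (xs ! i, Stay)) [0..<n])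
           | Branch k x q1 q2 \<Rightarrow>
               (if xs ! k = x then q1 else q2, map (\<lambda>i. (xs ! i, Stay)) [0..<n]))
        else (0, map (\<lambda>i. (xs ! i, Stay)) [0..<n])\<rparr>"

lemma is_tm_machine:
  assumes "\<And>i. i \<in> set code \<Longrightarrow> ok_instr (length code + 2) i"
  shows "is_tm (machine n code)"
proof -
  have 1: "fst (trans (machine n code) q xs) < num_states (machine n code)" for q xs
  proof (cases "q < length code")
    case True
    then have "ok_instr (length code + 2) (code ! q)"
      using assms by simp
    then show ?thesis
      using True by (cases "code ! q") (auto simp: machine_def)
  qed (simp add: machine_def)
  have 2: "length (snd (trans (machine n code) q xs)) = n" for q xs
    by (auto simp: machine_def split: instr.split)
  have 3: "fst ` set (snd (trans (machine n code) q xs)) \<subseteq> {..<3}"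
    if xs: "length xs = n" "set xs \<subseteq> {..<3}" for q xs
  proof -
    have nth: "xs ! i < 3" if "i < n" for i
    proof -
      have "xs ! i \<in> set xs"
        using that xs by simp
      then show ?thesis
        using xs by auto
    qed
    show ?thesis
    proof (cases "q < length code")
      case True
      then have "ok_instr (length code + 2) (code ! q)"
        using assms by simp
      then show ?thesis
        using True nth by (cases "code ! q") (auto simp: machine_def split: option.splits)
    qed (use nth in \<open>auto simp: machine_def\<close>)
  qed
  show ?thesis
    unfolding is_tm_def using 1 2 3 by (simp add: machine_def)
qed

definition tapes :: "nat \<Rightarrow> bool list list \<Rightarrow> (nat \<Rightarrow> nat) \<Rightarrow> tape list" where
  "tapes n ws s = map (\<lambda>k. tape_at ws k (s k)) [0..<n]"

lemma length_tapes [simp]: "length (tapes n ws s) = n"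
  by (simp add: tapes_def)

lemma nth_tapes [simp]: "i < n \<Longrightarrow> tapes n ws s ! i = tape_at ws i (s i)"
  by (simp add: tapes_def)

lemma act_tape_id [simp]: "act_tape T (read_tape T, Stay) = T"
  by (cases T) auto

lemma step_Branch:
  assumes "q < length code" "code ! q = Branch k x q1 q2" "k < n"
  shows "step (machine n code) (q, tapes n ws s) =
           (if sym ws k (s k) = x then q1 else q2, tapes n ws s)"
  using assms by (auto simp: step.simps machine_def sym_def intro!: nth_equalityI)

lemma step_Act:
  assumes "q < length code" "code ! q = Act k w d" "k < n" "length ts = n"
  shows "step (machine n code) (q, ts) =
           (Suc q, ts[k := act_tape (ts ! k) (case w of None \<Rightarrow> read_tape (ts ! k) | Some y \<Rightarrow> y, d)])"
  using assms
  by (auto simp: step.simps machine_def nth_list_update split: option.splits intro!: nth_equalityI)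

lemma tapes_update: "(tapes n ws s)[k := tape_at ws k v] = tapes n ws (s(k := v))"
  by (rule nth_equalityI) (auto simp: nth_list_update)

definition code_at :: "instr list \<Rightarrow> nat \<Rightarrow> instr list \<Rightarrow> bool" where
  "code_at code q xs \<longleftrightarrow> (\<forall>i < length xs. q + i < length code \<and> code ! (q + i) = xs ! i)"

lemma code_at_Nil [simp]: "code_at code q []"
  by (simp add: code_at_def)

lemma code_at_Cons [simp]:
  "code_at code q (x # xs) \<longleftrightarrow> q < length code \<and> code ! q = x \<and> code_at code (Suc q) xs"
  by (auto simp: code_at_def less_Suc_eq_0_disj)

lemma code_at_append [simp]:
  "code_at code q (xs @ ys) \<longleftrightarrow> code_at code q xs \<and> code_at code (q + length xs) ys"
  by (induction xs arbitrary: q) auto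

declare step.simps [simp del]

lemma steps_trans:
  "(step M ^^ t) c = d \<Longrightarrow> (step M ^^ t') d = e \<Longrightarrow> (step M ^^ (t + t')) c = e"
  by (simp add: add.commute[of t] funpow_add)

lemma steps_Suc: "step M c = d \<Longrightarrow> (step M ^^ t) d = e \<Longrightarrow> (step M ^^ Suc t) c = e"
  using steps_trans[of 1 M c d t e] by simp

lemma exec_compile:
  assumes "exec ws c s t s'" "code_at code q (compile (length ws) c q)" "tapes_used c \<subseteq> {..<n}"
  shows "(step (machine n code) ^^ t) (q, tapes n ws s) =
           (q + com_size (length ws) c, tapes n ws s')"
  using assms
proof (induction arbitrary: q rule: exec.induct)
  case (exec_Inc k s)
  let ?M = "machine n code"
  show ?case
  proof (cases "k < length ws")
    case True
    have "step ?M (q, tapes n ws s) = (Suc q, (tapes n ws s)[k := tape_at ws k (Suc (s k))])"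
      using exec_Inc True by (subst step_Act) (auto simp: tape_at_def add.commute)
    then have "step ?M (q, tapes n ws s) = (Suc q, tapes n ws (s(k := Suc (s k))))"
      by (simp only: tapes_update)
    then show ?thesis
      using steps_Suc[OF _ funpow_0, of ?M] True by (simp add: fun_upd_def)
  next
    case False
    \<comment> \<open>After the move alone the head stands on a blank next to the marks, which
      represents no register value; the second instruction repairs this.\<close>
    let ?T = "act_tape (tape_at ws k (s k)) (read_tape (tape_at ws k (s k)), Move_Right)"
    have 1: "step ?M (q, tapes n ws s) = (Suc q, (tapes n ws s)[k := ?T])"
      using exec_Inc False by (subst step_Act) auto
    have 2: "act_tape ?T (1, Stay) = tape_at ws k (Suc (s k))"
      using False by (auto simp: tape_at_def)
    have "step ?M (Suc q, (tapes n ws s)[k := ?T]) =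
        (Suc (Suc q), (tapes n ws s)[k := tape_at ws k (Suc (s k))])"
      using exec_Inc False by (subst step_Act) (auto simp flip: 2)
    then show ?thesis
      using steps_Suc[OF 1 steps_Suc[OF _ funpow_0, of ?M]] False
      by (simp add: tapes_update numeral_2_eq_2 fun_upd_def)
  qed
next
  case (exec_Dec s k v)
  let ?T = "tape_at ws k (s k)" and ?w = "if k < length ws then None else Some 0"
  have "act_tape ?T (case ?w of None \<Rightarrow> read_tape ?T | Some y \<Rightarrow> y, Move_Left) = tape_at ws k v"
    using exec_Dec by (auto simp: tape_at_def fun_eq_iff)
  then have "step (machine n code) (q, tapes n ws s) = (Suc q, (tapes n ws s)[k := tape_at ws k v])"
    using exec_Dec by (subst step_Act[where w = ?w]) auto
  then have "step (machine n code) (q, tapes n ws s) = (Suc q, tapes n ws (s(k := v)))"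
    by (simp only: tapes_update)
  then show ?case
    using steps_Suc[OF _ funpow_0, of "machine n code"] by (simp add: fun_upd_def)
next
  case (exec_Seq a s t s' b t' s'')
  then show ?case
    by (simp add: add.commute[of t] funpow_add add.assoc)
next
  case (exec_CondT k s x a t s' b)
  let ?q = "Suc q + com_size (length ws) a"
  let ?M = "machine n code"
  have 1: "step ?M (q, tapes n ws s) = (Suc q, tapes n ws s)"
    using exec_CondT by (subst step_Branch) (auto simp: Let_def)
  have 2: "(step ?M ^^ t) (Suc q, tapes n ws s) = (?q, tapes n ws s')"
    using exec_CondT by (auto simp: Let_def)
  have 3: "step ?M (?q, tapes n ws s') = (q + com_size (length ws) (Cond k x a b), tapes n ws s')"
    using exec_CondT.prems by (subst step_Branch) (auto simp: Let_def)
  show ?case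
  proof (rule steps_Suc[OF 1])
    show "(step ?M ^^ (t + 1)) (Suc q, tapes n ws s) =
        (q + com_size (length ws) (Cond k x a b), tapes n ws s')"
      using 2 3 by simp
  qed
next
  case (exec_CondF k s x b t s' a)
  let ?q = "Suc (Suc q + com_size (length ws) a)"
  let ?M = "machine n code"
  have 1: "step ?M (q, tapes n ws s) = (?q, tapes n ws s)"
    using exec_CondF by (subst step_Branch) (auto simp: Let_def)
  have 2: "(step ?M ^^ t) (?q, tapes n ws s) =
      (q + com_size (length ws) (Cond k x a b), tapes n ws s')"
    using exec_CondF by (auto simp: Let_def)
  show ?case
    using steps_Suc[OF 1 2] .
next
  case (exec_WhileF k s x a)
  have "step (machine n code) (q, tapes n ws s) =
      (q + com_size (length ws) (While k x a), tapes n ws s)"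
    using exec_WhileF by (subst step_Branch) (auto simp: Let_def)
  then show ?case by simp
next
  case (exec_WhileT k s x a t s' t' s'')
  let ?q = "Suc q + com_size (length ws) a"
  let ?M = "machine n code"
  have 1: "step ?M (q, tapes n ws s) = (Suc q, tapes n ws s)"
    using exec_WhileT by (subst step_Branch) (auto simp: Let_def)
  have 2: "(step ?M ^^ t) (Suc q, tapes n ws s) = (?q, tapes n ws s')"
    using exec_WhileT by (auto simp: Let_def)
  have 3: "step ?M (?q, tapes n ws s') = (q, tapes n ws s')"
    using exec_WhileT.prems by (subst step_Branch) (auto simp: Let_def)
  have 4: "(step ?M ^^ t') (q, tapes n ws s') =
      (q + com_size (length ws) (While k x a), tapes n ws s'')"
    using exec_WhileT by blast
  show ?case
    using steps_Suc[OF 1 steps_trans[OF 2 steps_Suc[OF 3 4]]] .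
qed simp

text \<open>The initial configuration is the one with all values zero, so a run may start from the
  zero state. One appended branch turns the result register into the verdict; it costs the
  additional step in \<open>p + 1\<close>.\<close>

lemma poly_time_decidableI:
  fixes p :: "nat poly"
  assumes "m \<le> r"
    and run: "\<And>ws. length ws = m \<Longrightarrow>
      \<exists>t \<le> poly p (sum_list (map length ws)). \<exists>s. exec ws c (\<lambda>_. 0) t s \<and> (0 < s r \<longleftrightarrow> P ws)"
  shows "poly_time_decidable m P"
proof -
  have "finite (insert r (tapes_used c))"
    by (simp add: finite_tapes_used)
  then obtain n where n: "tapes_used c \<subseteq> {..<n}" "r < n"
    by (auto simp: finite_nat_iff_bounded)
  define L where "L = com_size m c"
  define code where "code = compile m c 0 @ [Branch r 1 (Suc L) (Suc (Suc L))]"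
  define M where "M = machine n code"
  have len: "length code = Suc L"
    by (simp add: code_def L_def)
  have "is_tm M"
    unfolding M_def
  proof (rule is_tm_machine)
    fix i assume "i \<in> set code"
    then show "ok_instr (length code + 2) i"
      unfolding len using ok_instr_compile[of i m c 0 "Suc L + 2"]
      by (fastforce simp: code_def L_def)
  qed
  moreover have "m \<le> num_tapes M"
    using n assms(1) by (simp add: M_def machine_def)
  moreover have "\<exists>t \<le> poly (p + 1) (sum_list (map length ws)).
      fst ((step M ^^ t) (initial M ws)) = (if P ws then acc M else rej M)"
    if ws: "length ws = m" for ws
  proof -
    obtain t s where t: "t \<le> poly p (sum_list (map length ws))"
      and e: "exec ws c (\<lambda>_. 0) t s" and r: "0 < s r \<longleftrightarrow> P ws"
      using run[OF ws] by (elim exE conjE)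
    have init: "initial M ws = (0, tapes n ws (\<lambda>_. 0))"
      using n assms(1) ws
      by (auto simp: initial_def M_def machine_def nth_append tape_at_def input_tape_def fun_eq_iff
          intro!: nth_equalityI)
    have "code_at code 0 (compile m c 0)"
      by (simp add: code_at_def code_def nth_append)
    then have 1: "(step M ^^ t) (initial M ws) = (L, tapes n ws s)"
      using exec_compile[OF e, of code 0 n] n(1) unfolding init by (simp add: M_def L_def ws)
    have "code ! L = Branch r 1 (Suc L) (Suc (Suc L))"
      by (simp add: code_def L_def nth_append)
    then have "step M (L, tapes n ws s) = (if sym ws r (s r) = 1 then Suc L else Suc (Suc L), tapes n ws s)"
      unfolding M_def by (subst step_Branch) (use n len in auto)
    moreover have "sym ws r (s r) = 1 \<longleftrightarrow> P ws"
      using ws assms(1) r by (auto simp: sym_def tape_at_def)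
    ultimately have "fst ((step M ^^ Suc t) (initial M ws)) = (if P ws then acc M else rej M)"
      using 1 len by (auto simp: M_def machine_def)
    moreover have "Suc t \<le> poly (p + 1) (sum_list (map length ws))"
      using t by simp
    ultimately show ?thesis
      by (intro exI[of _ "Suc t"]) simp
  qed
  ultimately show ?thesis
    unfolding poly_time_decidable_def
    by (intro exI[of _ M] exI[of _ "p + 1"]) simp
qed

section \<open>Deciding first-order formulas in polynomial time\<close>

definition runs :: "bool list list \<Rightarrow> nat \<Rightarrow> com \<Rightarrow> (nat \<Rightarrow> nat) \<Rightarrow> (nat \<Rightarrow> nat) \<Rightarrow> bool" where
  "runs ws T c s s' \<longleftrightarrow> (\<exists>t \<le> T. exec ws c s t s')"

lemma runs_mono: "runs ws T c s s' \<Longrightarrow> T \<le> T' \<Longrightarrow> runs ws T' c s s'"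
  unfolding runs_def by (meson le_trans)

lemma runs_Skip: "runs ws 0 Skip s s"
  unfolding runs_def by (auto intro: exec_Skip)

lemma runs_Inc: "runs ws 2 (Inc k) s (s(k := Suc (s k)))"
  unfolding runs_def using exec_Inc[of ws k s]
  by (intro exI[of _ "if k < length ws then 1 else 2"]) simp

lemma runs_Dec: "s k = Suc v \<Longrightarrow> runs ws 1 (Dec k) s (s(k := v))"
  unfolding runs_def using exec_Dec by blast

lemma runs_Seq:
  "runs ws T a s s' \<Longrightarrow> runs ws T' b s' s'' \<Longrightarrow> runs ws (T + T') (a ;; b) s s''"
  unfolding runs_def using exec_Seq by (meson add_mono)

lemma runs_Cond:
  assumes "runs ws T (if sym ws k (s k) = x then a else b) s s'"
  shows "runs ws (T + 2) (Cond k x a b) s s'"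
proof -
  obtain t where t: "t \<le> T" "exec ws (if sym ws k (s k) = x then a else b) s t s'"
    using assms unfolding runs_def by blast
  show ?thesis
  proof (cases "sym ws k (s k) = x")
    case True
    then have "exec ws (Cond k x a b) s (Suc (t + 1)) s'"
      using t by (intro exec_CondT) auto
    then show ?thesis
      unfolding runs_def using t by (intro exI[of _ "Suc (t + 1)"]) simp
  next
    case False
    then have "exec ws (Cond k x a b) s (Suc t) s'"
      using t by (intro exec_CondF) auto
    then show ?thesis
      unfolding runs_def using t by (intro exI[of _ "Suc t"]) simp
  qed
qed

text \<open>The loop is described by its whole trajectory \<open>f\<close> of states, since every
  loop here runs a number of rounds known in advance. Each round pays two steps for the test and the
  jump back, and the final test pays one.\<close>

lemma runs_While:
  assumes "\<And>i. i < n \<Longrightarrow> sym ws k (f i k) = x \<and> runs ws T a (f i) (f (Suc i))"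
    and "sym ws k (f n k) \<noteq> x"
  shows "runs ws (n * (T + 2) + 1) (While k x a) (f 0) (f n)"
  using assms
proof (induction n arbitrary: f)
  case 0
  then show ?case
    unfolding runs_def by (auto intro!: exI[of _ 1] exec_WhileF)
next
  case (Suc n)
  have "runs ws (n * (T + 2) + 1) (While k x a) (f (Suc 0)) (f (Suc n))"
    using Suc.IH[of "\<lambda>i. f (Suc i)"] Suc.prems by simp
  then obtain t' where t': "t' \<le> n * (T + 2) + 1" "exec ws (While k x a) (f (Suc 0)) t' (f (Suc n))"
    unfolding runs_def by blast
  obtain t where t: "t \<le> T" "exec ws a (f 0) t (f (Suc 0))"
    using Suc.prems(1)[of 0] unfolding runs_def by blast
  have "exec ws (While k x a) (f 0) (Suc (t + Suc t')) (f (Suc n))"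
    using Suc.prems(1)[of 0] t t' by (intro exec_WhileT) auto
  moreover have "Suc (t + Suc t') \<le> Suc n * (T + 2) + 1"
    using t(1) t'(1) by simp
  ultimately show ?case
    unfolding runs_def by blast
qed

definition symbol :: "bool list \<Rightarrow> nat \<Rightarrow> nat" where
  "symbol w i = (if i < length w then if w ! i then 2 else 1 else 0)"

lemma sym_input: "k < length ws \<Longrightarrow> sym ws k v = symbol (ws ! k) v"
  by (simp add: sym_def tape_at_def input_tape_def symbol_def)

lemma sym_register: "length ws \<le> k \<Longrightarrow> sym ws k v = (if 0 < v then 1 else 0)"
  by (simp add: sym_def tape_at_def)

text \<open>Tapes 0 to 2 are reserved for inputs and tape 3 for the result. A variable occupies three
  tapes: its value, a shadow that holds the part of the value already consumed by a running loop,
  and a counter for the falsifying instances found by a quantifier.\<close>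

definition val :: "nat \<Rightarrow> nat" where "val v = 4 + 3 * v"
definition shadow :: "nat \<Rightarrow> nat" where "shadow v = 5 + 3 * v"
definition counter :: "nat \<Rightarrow> nat" where "counter v = 6 + 3 * v"

lemma register_distinct [simp]:
  "val v = val w \<longleftrightarrow> v = w" "shadow v = shadow w \<longleftrightarrow> v = w" "counter v = counter w \<longleftrightarrow> v = w"
  "val v \<noteq> shadow w" "shadow w \<noteq> val v" "val v \<noteq> counter w" "counter w \<noteq> val v"
  "shadow v \<noteq> counter w" "counter w \<noteq> shadow v"
  unfolding val_def shadow_def counter_def by (simp, simp, simp) presburger+

lemma register_ge: "3 < val v" "3 < shadow v" "3 < counter v"
  unfolding val_def shadow_def counter_def by simp_all

section \<open>Terms as iteration counts\<close>

datatype trm = Zero | One | Plus trm trm | Times nat trm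

fun tval :: "trm \<Rightarrow> (nat \<Rightarrow> nat) \<Rightarrow> nat" where
  "tval Zero e = 0"
| "tval One e = 1"
| "tval (Plus t u) e = tval t e + tval u e"
| "tval (Times v t) e = e v * tval t e"

fun vars :: "trm \<Rightarrow> nat set" where
  "vars Zero = {}"
| "vars One = {}"
| "vars (Plus t u) = vars t \<union> vars u"
| "vars (Times v t) = insert v (vars t)"

text \<open>A repetition over a variable drains its tape, so the variable must not recur in the body.\<close>

fun wf_trm :: "trm \<Rightarrow> bool" where
  "wf_trm Zero \<longleftrightarrow> True"
| "wf_trm One \<longleftrightarrow> True"
| "wf_trm (Plus t u) \<longleftrightarrow> wf_trm t \<and> wf_trm u"
| "wf_trm (Times v t) \<longleftrightarrow> v \<notin> vars t \<and> wf_trm t"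

lemma tval_cong: "(\<And>v. v \<in> vars t \<Longrightarrow> e v = e' v) \<Longrightarrow> tval t e = tval t e'"
  by (induction t) auto

text \<open>Multiplication is a nested loop: \<open>c\<close> runs once for each unit of the value
  of the term. The second loop moves the drained value back, so that the variable can be read
  again.\<close>

fun repeat :: "trm \<Rightarrow> com \<Rightarrow> com" where
  "repeat Zero c = Skip"
| "repeat One c = c"
| "repeat (Plus t u) c = repeat t c ;; repeat u c"
| "repeat (Times v t) c =
     While (val v) 1 (Dec (val v) ;; Inc (shadow v) ;; repeat t c) ;;
     While (shadow v) 1 (Dec (shadow v) ;; Inc (val v))"

definition pX :: "nat poly" where "pX = [:0, 1:]"

lemma poly_pX [simp]: "poly pX n = n"
  by (simp add: pX_def)

text \<open>The body is assumed to take at most two steps, which covers \<open>Inc\<close> and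
  \<open>Dec\<close>. Each 5 is one step for \<open>Dec\<close>, two for \<open>Inc\<close> and two
  for the round of the loop.\<close>

fun repeat_time :: "trm \<Rightarrow> nat poly" where
  "repeat_time Zero = 0"
| "repeat_time One = 2"
| "repeat_time (Plus t u) = repeat_time t + repeat_time u"
| "repeat_time (Times v t) = pX * (repeat_time t + 5) + 1 + (pX * 5 + 1)"

text \<open>The start index \<open>lo\<close> lets the two halves of a sum and the rounds of a
  product continue one sequence \<open>h\<close> of values of register \<open>k\<close>. The premise
  on \<open>c\<close> ranges over all states because the surrounding loops have changed other
  registers when \<open>c\<close> runs.\<close>

lemma runs_repeat:
  assumes "length ws \<le> 3" "wf_trm t"
    and "\<And>s i. lo \<le> i \<Longrightarrow> i < lo + tval t (\<lambda>v. s0 (val v)) \<Longrightarrow>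
           runs ws 2 c (s(k := h i)) (s(k := h (Suc i)))"
    and "\<And>v. v \<in> vars t \<Longrightarrow> s0 (shadow v) = 0 \<and> s0 (val v) \<le> n \<and> k \<noteq> val v \<and> k \<noteq> shadow v"
  shows "runs ws (poly (repeat_time t) n) (repeat t c)
           (s0(k := h lo)) (s0(k := h (lo + tval t (\<lambda>v. s0 (val v)))))"
  using assms
proof (induction t arbitrary: lo s0)
  case Zero
  then show ?case by (simp add: runs_Skip)
next
  case One
  then show ?case by simp
next
  case (Plus t u)
  let ?l = "lo + tval t (\<lambda>v. s0 (val v))"
  have "runs ws (poly (repeat_time t) n) (repeat t c) (s0(k := h lo)) (s0(k := h ?l))"
    using Plus.prems by (intro Plus.IH) auto
  moreover have "runs ws (poly (repeat_time u) n) (repeat u c) (s0(k := h ?l))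
      (s0(k := h (?l + tval u (\<lambda>v. s0 (val v)))))"
    using Plus.prems by (intro Plus.IH) auto
  ultimately show ?case
    using runs_Seq by (simp add: add.assoc fun_upd_def)
next
  case (Times v t)
  define a where "a = s0 (val v)"
  define b where "b = tval t (\<lambda>v. s0 (val v))"
  \<comment> \<open>\<open>f i\<close> is the state after \<open>i\<close> rounds of the draining
    loop, \<open>g i\<close> after \<open>i\<close> rounds of the restoring loop; in both, value and
    shadow add up to \<open>a\<close>. A full draining loop advances the index of \<open>h\<close>
    by \<open>a * b\<close>.\<close>
  define f where "f i = s0(val v := a - i, shadow v := i, k := h (lo + i * b))" for i
  define g where "g i = s0(val v := i, shadow v := a - i, k := h (lo + a * b))" for i
  have k: "k \<noteq> val v" "k \<noteq> shadow v" and a: "a \<le> n" and sh: "s0 (shadow v) = 0"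
    using Times.prems(4)[of v] by (auto simp: a_def)
  have big: "length ws \<le> val w" "length ws \<le> shadow w" for w
    using Times.prems(1) register_ge[of w] by auto
  have body: "runs ws (poly (repeat_time t) n + 3)
      (Dec (val v) ;; Inc (shadow v) ;; repeat t c) (f i) (f (Suc i))" if i: "i < a" for i
  proof -
    define s1 where "s1 = s0(val v := a - Suc i, shadow v := Suc i)"
    have tv: "tval t (\<lambda>w. s1 (val w)) = b"
      unfolding b_def using Times.prems(2) by (intro tval_cong) (auto simp: s1_def)
    have 1: "runs ws 1 (Dec (val v)) (f i) ((f i)(val v := a - Suc i))"
      using i k by (intro runs_Dec) (simp add: f_def)
    have 2: "runs ws 2 (Inc (shadow v)) ((f i)(val v := a - Suc i)) (s1(k := h (lo + i * b)))"
    proof -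
      have "((f i)(val v := a - Suc i))(shadow v := Suc (((f i)(val v := a - Suc i)) (shadow v))) =
          s1(k := h (lo + i * b))"
        using k by (auto simp: f_def s1_def fun_eq_iff)
      then show ?thesis
        using runs_Inc by metis
    qed
    have le: "lo + i * b + b \<le> lo + a * b"
      using i mult_le_mono1[of "Suc i" a b] by simp
    have 3: "runs ws (poly (repeat_time t) n) (repeat t c) (s1(k := h (lo + i * b)))
        (s1(k := h (lo + i * b + tval t (\<lambda>w. s1 (val w)))))"
    proof (rule Times.IH)
      show "runs ws 2 c (s(k := h j)) (s(k := h (Suc j)))"
        if "lo + i * b \<le> j" "j < lo + i * b + tval t (\<lambda>v. s1 (val v))" for s j
        by (rule Times.prems(3)) (use that le in \<open>simp_all add: tv a_def b_def\<close>)
      show "s1 (shadow w) = 0 \<and> s1 (val w) \<le> n \<and> k \<noteq> val w \<and> k \<noteq> shadow w"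
        if "w \<in> vars t" for w
        using Times.prems that by (auto simp: s1_def)
    qed (use Times.prems in auto)
    have "s1(k := h (lo + i * b + tval t (\<lambda>w. s1 (val w)))) = f (Suc i)"
      unfolding tv by (auto simp: s1_def f_def fun_eq_iff algebra_simps)
    then show ?thesis
      using runs_Seq[OF 1 runs_Seq[OF 2 3]] by (simp add: numeral_3_eq_3)
  qed
  have "runs ws (a * (poly (repeat_time t) n + 3 + 2) + 1)
      (While (val v) 1 (Dec (val v) ;; Inc (shadow v) ;; repeat t c)) (f 0) (f a)"
  proof (rule runs_While)
    have "f i (val v) = a - i" for i
      using k by (simp add: f_def)
    then show "sym ws (val v) (f a (val v)) \<noteq> 1"
      and "\<And>i. i < a \<Longrightarrow> sym ws (val v) (f i (val v)) = 1 \<and> runs ws (poly (repeat_time t) n + 3)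
         (Dec (val v) ;; Inc (shadow v) ;; repeat t c) (f i) (f (Suc i))"
      using body big by (simp_all add: sym_register)
  qed
  moreover have "f 0 = s0(k := h lo)"
    using k sh by (auto simp: f_def a_def fun_eq_iff)
  moreover have "f a = g 0"
    by (simp add: f_def g_def)
  ultimately have 1: "runs ws (a * (poly (repeat_time t) n + 5) + 1)
      (While (val v) 1 (Dec (val v) ;; Inc (shadow v) ;; repeat t c)) (s0(k := h lo)) (g 0)"
    by (simp add: add.commute)
  have restore: "runs ws 3 (Dec (shadow v) ;; Inc (val v)) (g i) (g (Suc i))" if i: "i < a" for i
  proof -
    have 1: "runs ws 1 (Dec (shadow v)) (g i) ((g i)(shadow v := a - Suc i))"
      using i k by (intro runs_Dec) (simp add: g_def)
    have "((g i)(shadow v := a - Suc i))(val v := Suc (((g i)(shadow v := a - Suc i)) (val v))) =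
        g (Suc i)"
      using k by (auto simp: g_def fun_eq_iff)
    then have 2: "runs ws 2 (Inc (val v)) ((g i)(shadow v := a - Suc i)) (g (Suc i))"
      using runs_Inc by metis
    show ?thesis
      using runs_Seq[OF 1 2] by (simp add: numeral_3_eq_3)
  qed
  have "runs ws (a * (3 + 2) + 1) (While (shadow v) 1 (Dec (shadow v) ;; Inc (val v))) (g 0) (g a)"
  proof (rule runs_While)
    have "g i (shadow v) = a - i" for i
      using k by (simp add: g_def)
    then show "sym ws (shadow v) (g a (shadow v)) \<noteq> 1"
      and "\<And>i. i < a \<Longrightarrow> sym ws (shadow v) (g i (shadow v)) = 1 \<and>
         runs ws 3 (Dec (shadow v) ;; Inc (val v)) (g i) (g (Suc i))"
      using restore big by (simp_all add: sym_register)
  qed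
  moreover have "g a = s0(k := h (lo + a * b))"
    using k sh by (auto simp: g_def a_def fun_eq_iff)
  ultimately have 2: "runs ws (a * 5 + 1) (While (shadow v) 1 (Dec (shadow v) ;; Inc (val v)))
      (g 0) (s0(k := h (lo + a * b)))"
    by simp
  have "a * (poly (repeat_time t) n + 5) + 1 + (a * 5 + 1) \<le> poly (repeat_time (Times v t)) n"
    using a by (simp add: mult_le_mono add_mono)
  then show ?case
    using runs_mono[OF runs_Seq[OF 1 2]] by (simp add: a_def b_def fun_upd_def)
qed

section \<open>Formulas and their compilation\<close>

datatype fm = Sym nat nat trm | Neg fm | Conj fm fm | All nat fm

fun eval :: "bool list list \<Rightarrow> fm \<Rightarrow> (nat \<Rightarrow> nat) \<Rightarrow> bool" where
  "eval ws (Sym k x t) e \<longleftrightarrow> symbol (ws ! k) (tval t e) = x"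
| "eval ws (Neg a) e \<longleftrightarrow> \<not> eval ws a e"
| "eval ws (Conj a b) e \<longleftrightarrow> eval ws a e \<and> eval ws b e"
| "eval ws (All v a) e \<longleftrightarrow> (\<forall>x < e 0. eval ws a (e(v := x)))"

fun bound_vars :: "fm \<Rightarrow> nat set" where
  "bound_vars (Sym k x t) = {}"
| "bound_vars (Neg a) = bound_vars a"
| "bound_vars (Conj a b) = bound_vars a \<union> bound_vars b"
| "bound_vars (All v a) = insert v (bound_vars a)"

text \<open>Variables 0 and 1 both hold the size of the universe: two copies are needed to count up to
  its square.\<close>

fun wf_fm :: "nat \<Rightarrow> fm \<Rightarrow> bool" where
  "wf_fm m (Sym k x t) \<longleftrightarrow> k < m \<and> wf_trm t"
| "wf_fm m (Neg a) \<longleftrightarrow> wf_fm m a"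
| "wf_fm m (Conj a b) \<longleftrightarrow> wf_fm m a \<and> wf_fm m b"
| "wf_fm m (All v a) \<longleftrightarrow> 2 \<le> v \<and> v \<notin> bound_vars a \<and> wf_fm m a"

text \<open>Continuation passing: the truth value lives in the control flow and needs no register.
  This duplicates \<open>p\<close> and \<open>q\<close> in the code, which is harmless for a fixed
  formula. Structured code cannot leave a loop with a verdict, so the quantifier counts the
  falsifying values and decides afterwards.\<close>

fun branch :: "fm \<Rightarrow> com \<Rightarrow> com \<Rightarrow> com" where
  "branch (Sym k x t) p q =
     repeat t (Inc k) ;; Cond k x (repeat t (Dec k) ;; p) (repeat t (Dec k) ;; q)"
| "branch (Neg a) p q = branch a q p"
| "branch (Conj a b) p q = branch a (branch b p q) q"
| "branch (All v a) p q =
     repeat (Times 0 One) (Inc (val v)) ;;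
     While (val v) 1 (Dec (val v) ;; branch a Skip (Inc (counter v))) ;;
     Cond (counter v) 1 (While (counter v) 1 (Dec (counter v)) ;; q) p"

fun branch_time :: "fm \<Rightarrow> nat poly" where
  "branch_time (Sym k x t) = repeat_time t + repeat_time t + 2"
| "branch_time (Neg a) = branch_time a"
| "branch_time (Conj a b) = branch_time a + branch_time b"
| "branch_time (All v a) =
     repeat_time (Times 0 One) + (pX * (branch_time a + 5) + 1) + (pX * 3 + 1) + 2"

text \<open>Both continuations start in the original state \<open>s\<close>, since heads are moved
  back and registers emptied before either is entered. This is what allows tests to be nested and
  repeated, and it makes the time \<open>T\<close> of the continuation a mere summand.\<close>

lemma runs_branch:
  assumes "length ws \<le> 3" "wf_fm (length ws) \<phi>"
    and "\<And>k. k < length ws \<Longrightarrow> s k = 0" "\<And>v. s (shadow v) = 0"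
    and "\<And>v. v \<in> bound_vars \<phi> \<Longrightarrow> s (val v) = 0 \<and> s (counter v) = 0"
    and "\<And>v. s (val v) \<le> n" "s (val 0) = n"
    and "runs ws T (if eval ws \<phi> (\<lambda>v. s (val v)) then p else q) s s'"
  shows "runs ws (T + poly (branch_time \<phi>) n) (branch \<phi> p q) s s'"
  using assms
proof (induction \<phi> arbitrary: T p q s s')
  case (Sym k x t)
  let ?e = "\<lambda>v. s (val v)"
  let ?N = "tval t ?e"
  have k: "k < length ws" "wf_trm t" "s k = 0"
    using Sym.prems by auto
  have kne: "k \<noteq> val v" "k \<noteq> shadow v" for v
    using k(1) Sym.prems(1) register_ge[of v] by auto
  have "runs ws (poly (repeat_time t) n) (repeat t (Inc k)) (s(k := 0)) (s(k := (0 + ?N)))"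
  proof (rule runs_repeat[where h = "\<lambda>i. i"])
    show "runs ws 2 (Inc k) (s(k := i)) (s(k := Suc i))" for s i
      using runs_Inc[of ws k "s(k := i)"] by simp
  qed (use Sym.prems k kne in auto)
  then have 1: "runs ws (poly (repeat_time t) n) (repeat t (Inc k)) s (s(k := ?N))"
    using k(3) by (simp add: fun_upd_idem)
  have "runs ws (poly (repeat_time t) n) (repeat t (Dec k)) (s(k := ?N - 0)) (s(k := ?N - (0 + ?N)))"
  proof (rule runs_repeat[where h = "\<lambda>i. ?N - i"])
    show "runs ws 2 (Dec k) (s'(k := ?N - i)) (s'(k := ?N - Suc i))" if "i < 0 + ?N" for s' i
    proof -
      have "runs ws 1 (Dec k) (s'(k := ?N - i)) ((s'(k := ?N - i))(k := ?N - Suc i))"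
        using that by (intro runs_Dec) auto
      then show ?thesis
        by (auto intro: runs_mono)
    qed
  qed (use Sym.prems k kne in auto)
  then have 2: "runs ws (poly (repeat_time t) n) (repeat t (Dec k)) (s(k := ?N)) s"
    using k(3) by (simp add: fun_upd_idem)
  have "runs ws (poly (repeat_time t) n + T)
      (if sym ws k ((s(k := ?N)) k) = x then repeat t (Dec k) ;; p else repeat t (Dec k) ;; q)
      (s(k := ?N)) s'"
    using Sym.prems(8) k(1) by (auto simp: sym_input intro: runs_Seq[OF 2])
  from runs_Seq[OF 1 runs_Cond[OF this]] show ?case
    by (simp add: ac_simps)
next
  case (Neg a)
  then show ?case
    by (cases "eval ws a (\<lambda>v. s (val v))") simp_all
next
  case (Conj a b)
  let ?e = "\<lambda>v. s (val v)"
  have "runs ws (T + poly (branch_time b) n) (if eval ws a ?e then branch b p q else q) s s'"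
  proof (cases "eval ws a ?e")
    case True
    have "runs ws (T + poly (branch_time b) n) (branch b p q) s s'"
      using Conj.prems True by (intro Conj.IH(2)) auto
    then show ?thesis
      using True by simp
  next
    case False
    then show ?thesis
      using Conj.prems(8) by (auto intro: runs_mono)
  qed
  then have "runs ws (T + poly (branch_time b) n + poly (branch_time a) n) (branch a (branch b p q) q) s s'"
    using Conj.prems by (intro Conj.IH(1)) auto
  then show ?case
    by (simp add: ac_simps)
next
  case (All v a)
  let ?e = "\<lambda>v. s (val v)"
  define P where "P x \<longleftrightarrow> eval ws a (?e(v := x))" for x
  \<comment> \<open>The decrement precedes the test, so round \<open>j\<close> tests the value
    \<open>n - Suc j\<close>: the values run from \<open>n - 1\<close> down to 0, and
    \<open>f j\<close> counts the failures among the first \<open>j\<close> of them.\<close>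
  define f where "f j = (\<Sum>i<j. if P (n - Suc i) then 0 else 1 :: nat)" for j
  define g where "g j = s(val v := n - j, counter v := f j)" for j
  have v: "2 \<le> v" "v \<notin> bound_vars a" "s (val v) = 0" "s (counter v) = 0"
    using All.prems by auto
  have big: "length ws \<le> val w" "length ws \<le> counter w" for w
    using All.prems(1) register_ge[of w] by auto
  have small: "w \<noteq> val u" "w \<noteq> counter u" if "w < length ws" for w u
    using All.prems(1) that register_ge[of u] by auto
  have "runs ws (poly (repeat_time (Times 0 One)) n) (repeat (Times 0 One) (Inc (val v)))
      (s(val v := 0)) (s(val v := 0 + tval (Times 0 One) ?e))"
  proof (rule runs_repeat[where h = "\<lambda>i. i"])
    show "runs ws 2 (Inc (val v)) (s(val v := i)) (s(val v := Suc i))" for s i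
      using runs_Inc[of ws "val v" "s(val v := i)"] by simp
  qed (use All.prems v in auto)
  moreover have "s(val v := 0) = s" "s(val v := 0 + tval (Times 0 One) ?e) = g 0"
    using v All.prems(7) by (auto simp: g_def f_def fun_eq_iff)
  ultimately have 1: "runs ws (poly (repeat_time (Times 0 One)) n)
      (repeat (Times 0 One) (Inc (val v))) s (g 0)"
    by metis
  have body: "runs ws (poly (branch_time a) n + 3)
      (Dec (val v) ;; branch a Skip (Inc (counter v))) (g j) (g (Suc j))" if j: "j < n" for j
  proof -
    define s1 where "s1 = s(val v := n - Suc j, counter v := f j)"
    have "(g j)(val v := n - Suc j) = s1"
      by (auto simp: g_def s1_def fun_eq_iff)
    then have 1: "runs ws 1 (Dec (val v)) (g j) s1"
      using runs_Dec[of "g j" "val v" "n - Suc j" ws] j by (simp add: g_def Suc_diff_Suc)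
    have e: "(\<lambda>w. s1 (val w)) = ?e(v := n - Suc j)"
      by (auto simp: s1_def)
    have test: "runs ws 2 (if eval ws a (\<lambda>w. s1 (val w)) then Skip else Inc (counter v)) s1 (g (Suc j))"
    proof (cases "P (n - Suc j)")
      case True
      then have "g (Suc j) = s1"
        by (simp add: g_def s1_def f_def)
      then show ?thesis
        using True e runs_mono[OF runs_Skip] by (simp add: P_def)
    next
      case False
      then have "g (Suc j) = s1(counter v := Suc (s1 (counter v)))"
        by (simp add: g_def s1_def f_def)
      then show ?thesis
        using False e runs_Inc[of ws "counter v" s1] by (simp add: P_def)
    qed
    have 2: "runs ws (2 + poly (branch_time a) n) (branch a Skip (Inc (counter v))) s1 (g (Suc j))"
    proof (rule All.IH)
      show "runs ws 2 (if eval ws a (\<lambda>w. s1 (val w)) then Skip else Inc (counter v)) s1 (g (Suc j))"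
        by (fact test)
    qed (use All.prems v small in \<open>auto simp: s1_def\<close>)
    show ?thesis
      using runs_Seq[OF 1 2] by (rule runs_mono) simp
  qed
  have f_le: "f n \<le> n"
    using sum_bounded_above[of "{..<n}" "\<lambda>i. if P (n - Suc i) then 0 else 1 :: nat" 1]
    by (simp add: f_def)
  have f0: "f n = 0 \<longleftrightarrow> eval ws (All v a) ?e"
  proof -
    have "f n = 0 \<longleftrightarrow> (\<forall>i<n. P (n - Suc i))"
      by (auto simp: f_def)
    also have "\<dots> \<longleftrightarrow> (\<forall>i<n. P i)"
      by (metis Suc_diff_Suc diff_Suc_less diff_diff_cancel less_imp_le_nat Suc_leI zero_less_diff
          less_nat_zero_code not_gr_zero)
    finally show ?thesis
      using All.prems(7) by (simp add: P_def)
  qed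
  have 2: "runs ws (n * (poly (branch_time a) n + 3 + 2) + 1)
      (While (val v) 1 (Dec (val v) ;; branch a Skip (Inc (counter v)))) (g 0) (g n)"
  proof (rule runs_While)
    have "g j (val v) = n - j" for j
      by (simp add: g_def)
    then show "sym ws (val v) (g n (val v)) \<noteq> 1"
      and "\<And>j. j < n \<Longrightarrow> sym ws (val v) (g j (val v)) = 1 \<and> runs ws (poly (branch_time a) n + 3)
         (Dec (val v) ;; branch a Skip (Inc (counter v))) (g j) (g (Suc j))"
      using body big by (simp_all add: sym_register)
  qed
  have 3: "runs ws (f n * (1 + 2) + 1 + T)
      (if sym ws (counter v) (g n (counter v)) = 1
       then While (counter v) 1 (Dec (counter v)) ;; q else p) (g n) s'"
  proof (cases "f n = 0")
    case True
    then have "g n = s"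
      using v by (auto simp: g_def fun_eq_iff)
    moreover have "runs ws T p s s'"
      using True f0 All.prems(8) by presburger
    ultimately show ?thesis
      using True big v by (auto simp: sym_register intro: runs_mono)
  next
    case False
    define h where "h i = s(counter v := f n - i)" for i
    have "runs ws (f n * (1 + 2) + 1) (While (counter v) 1 (Dec (counter v))) (h 0) (h (f n))"
    proof (rule runs_While)
      fix i assume i: "i < f n"
      have "(h i)(counter v := f n - Suc i) = h (Suc i)"
        by (simp add: h_def)
      then have "runs ws 1 (Dec (counter v)) (h i) (h (Suc i))"
        using runs_Dec[of "h i" "counter v" "f n - Suc i" ws] i by (simp add: h_def Suc_diff_Suc)
      then show "sym ws (counter v) (h i (counter v)) = 1 \<and> runs ws 1 (Dec (counter v)) (h i) (h (Suc i))"
        using i big by (simp add: h_def sym_register)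
    qed (use big in \<open>simp add: h_def sym_register\<close>)
    moreover have "h 0 = g n" "h (f n) = s"
      using v by (auto simp: h_def g_def fun_eq_iff)
    moreover have "runs ws T q s s'"
      using False f0 All.prems(8) by presburger
    ultimately have "runs ws (f n * (1 + 2) + 1 + T) (While (counter v) 1 (Dec (counter v)) ;; q) (g n) s'"
      using runs_Seq by metis
    then show ?thesis
      using False big by (simp add: g_def sym_register)
  qed
  show ?case
    unfolding branch.simps
    by (rule runs_mono[OF runs_Seq[OF 1 runs_Seq[OF 2 runs_Cond[OF 3]]]]) (use f_le in \<open>simp add: algebra_simps\<close>)
qed

lemma eval_cong:
  assumes "wf_fm m \<phi>" "\<And>k. k < m \<Longrightarrow> ws ! k = ws' ! k"
  shows "eval ws \<phi> e = eval ws' \<phi> e"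
  using assms by (induction \<phi> arbitrary: e) auto

section \<open>From the input words to a run of the verifier\<close>

definition prefix :: "bool list \<Rightarrow> nat" where
  "prefix w = length (takeWhile id w)"

definition sizes :: "nat \<Rightarrow> nat \<Rightarrow> nat" where
  "sizes n = (\<lambda>v. if v < 2 then n else 0)"

lemma poly_nat_mono: "a \<le> b \<Longrightarrow> poly p a \<le> poly p b" for p :: "nat poly"
  by (induction p) (auto intro: add_mono mult_mono)

text \<open>The size of the universe is read off the leading ones of the first word, hence is at
  most the length of that word; a bound polynomial in the size is thus polynomial in the total input
  length.\<close>

theorem poly_time_decidable_fm:
  assumes "0 < m" "m \<le> 3" "wf_fm m \<phi>" "0 \<notin> bound_vars \<phi>" "1 \<notin> bound_vars \<phi>"
  shows "poly_time_decidable m (\<lambda>ws. eval ws \<phi> (sizes (prefix (ws ! 0))))"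
proof -
  define read where "read = While 0 2 (Inc 0 ;; Inc (val 0) ;; Inc (val 1))"
  \<comment> \<open>Reading leaves the head of tape 0 at position \<open>n\<close>, and variable 0
    already holds \<open>n\<close>, so this performs exactly \<open>n\<close> decrements.\<close>
  define rewind where "rewind = repeat (Times 0 One) (Dec 0)"
  define c where "c = read ;; rewind ;; branch \<phi> (Inc 3) Skip"
  define p where "p = (pX * 8 + 1) + (repeat_time (Times 0 One) + (2 + branch_time \<phi>))"
  show ?thesis
  proof (rule poly_time_decidableI[of m 3 p c])
    fix ws :: "bool list list"
    assume ws: "length ws = m"
    define n where "n = prefix (ws ! 0)"
    have n: "n \<le> length (ws ! 0)"
      by (simp add: n_def prefix_def length_takeWhile_le)
    have sym0: "sym ws 0 i = 2 \<longleftrightarrow> i < length (ws ! 0) \<and> ws ! 0 ! i" for i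
      using ws assms(1) by (simp add: sym_input symbol_def)
    have z: "0 \<noteq> val v" "val v \<noteq> 0" "0 \<noteq> shadow v" for v
      using register_ge[of v] by auto
    define f where "f i = (\<lambda>_. 0 :: nat)(0 := i, val 0 := i, val 1 := i)" for i
    define s where "s = (\<lambda>_. 0 :: nat)(val 0 := n, val 1 := n)"
    have "runs ws (n * (6 + 2) + 1) read (f 0) (f n)"
      unfolding read_def
    proof (rule runs_While)
      fix i assume i: "i < n"
      have i': "i < length (ws ! 0)"
        using i n by simp
      have "ws ! 0 ! i"
        using i nth_mem[of i "takeWhile id (ws ! 0)"] set_takeWhileD[of _ id "ws ! 0"]
        by (auto simp: n_def prefix_def takeWhile_nth)
      moreover have "runs ws (2 + (2 + 2)) (Inc 0 ;; Inc (val 0) ;; Inc (val 1)) (f i)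
          ((f i)(0 := Suc (f i 0), val 0 := Suc (f i (val 0)), val 1 := Suc (f i (val 1))))"
      proof (intro runs_Seq)
        show "runs ws 2 (Inc 0) (f i) ((f i)(0 := Suc (f i 0)))"
          by (rule runs_Inc)
        show "runs ws 2 (Inc (val 0)) ((f i)(0 := Suc (f i 0)))
            ((f i)(0 := Suc (f i 0), val 0 := Suc (f i (val 0))))"
          using runs_Inc[of ws "val 0" "(f i)(0 := Suc (f i 0))"] by (simp add: z)
        show "runs ws 2 (Inc (val 1)) ((f i)(0 := Suc (f i 0), val 0 := Suc (f i (val 0))))
            ((f i)(0 := Suc (f i 0), val 0 := Suc (f i (val 0)), val 1 := Suc (f i (val 1))))"
          using runs_Inc[of ws "val 1" "(f i)(0 := Suc (f i 0), val 0 := Suc (f i (val 0)))"]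
          by (simp add: z)
      qed
      moreover have "(f i)(0 := Suc (f i 0), val 0 := Suc (f i (val 0)), val 1 := Suc (f i (val 1)))
          = f (Suc i)"
        using z by (auto simp: f_def fun_eq_iff)
      ultimately show "sym ws 0 (f i 0) = 2 \<and>
          runs ws 6 (Inc 0 ;; Inc (val 0) ;; Inc (val 1)) (f i) (f (Suc i))"
        using i' z by (simp add: sym0 f_def)
    next
      have "\<not> (n < length (ws ! 0) \<and> ws ! 0 ! n)"
        using nth_length_takeWhile[of id "ws ! 0"] by (auto simp: n_def prefix_def)
      then show "sym ws 0 (f n 0) \<noteq> 2"
        using z by (simp add: sym0 f_def)
    qed
    moreover have "f 0 = (\<lambda>_. 0)" "f n = s(0 := n - 0)"
      by (auto simp: z f_def s_def fun_eq_iff)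
    ultimately have 1: "runs ws (n * 8 + 1) read (\<lambda>_. 0) (s(0 := n - 0))"
      by simp
    have tv: "tval (Times 0 One) (\<lambda>v. s (val v)) = n"
      by (simp add: s_def)
    have "runs ws (poly (repeat_time (Times 0 One)) n) rewind (s(0 := n - 0))
        (s(0 := n - (0 + tval (Times 0 One) (\<lambda>v. s (val v)))))"
      unfolding rewind_def
    proof (rule runs_repeat[where h = "\<lambda>i. n - i"])
      show "runs ws 2 (Dec 0) (s'(0 := n - i)) (s'(0 := n - Suc i))"
        if "i < 0 + tval (Times 0 One) (\<lambda>v. s (val v))" for s' i
      proof -
        have "runs ws 1 (Dec 0) (s'(0 := n - i)) ((s'(0 := n - i))(0 := n - Suc i))"
          using that[unfolded tv] by (intro runs_Dec) (simp add: Suc_diff_Suc)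
        then show ?thesis
          by (auto intro: runs_mono)
      qed
    qed (use ws assms z in \<open>auto simp: s_def\<close>)
    moreover have "s(0 := n - (0 + tval (Times 0 One) (\<lambda>v. s (val v)))) = s"
      unfolding tv by (auto simp: z s_def fun_eq_iff)
    ultimately have 2: "runs ws (poly (repeat_time (Times 0 One)) n) rewind (s(0 := n - 0)) s"
      by simp
    define P where "P \<longleftrightarrow> eval ws \<phi> (sizes n)"
    have e: "(\<lambda>v. s (val v)) = sizes n"
      by (auto simp: s_def sizes_def fun_eq_iff)
    define s' where "s' = (if P then s(3 := Suc (s 3)) else s)"
    have "runs ws 2 (if P then Inc 3 else Skip) s s'"
      using runs_Inc[of ws 3 s] runs_mono[OF runs_Skip[of ws s], of 2] by (auto simp: s'_def)
    then have 3: "runs ws (2 + poly (branch_time \<phi>) n) (branch \<phi> (Inc 3) Skip) s s'"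
    proof (intro runs_branch)
      show "s k = 0" if "k < length ws" for k
        using that ws assms(2) register_ge(1)[of 0] register_ge(1)[of 1] by (auto simp: s_def)
      show "s (val v) = 0 \<and> s (counter v) = 0" if "v \<in> bound_vars \<phi>" for v
        using that assms by (auto simp: s_def)
    qed (use ws assms e in \<open>auto simp: s_def P_def\<close>)
    have "runs ws (poly p n) c (\<lambda>_. 0) s'"
      using runs_Seq[OF 1 runs_Seq[OF 2 3]] by (simp add: c_def p_def)
    then obtain t where t: "t \<le> poly p n" "exec ws c (\<lambda>_. 0) t s'"
      unfolding runs_def by blast
    have "length (ws ! 0) \<le> sum_list (map length ws)"
      using ws assms(1) by (intro member_le_sum_list) auto
    then have "poly p n \<le> poly p (sum_list (map length ws))"
      using n by (intro poly_nat_mono) simp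
    moreover have "0 < s' 3 \<longleftrightarrow> P"
      using register_ge(1)[of 0] register_ge(1)[of 1] by (auto simp: s'_def s_def)
    ultimately show "\<exists>t \<le> poly p (sum_list (map length ws)).
        \<exists>s. exec ws c (\<lambda>_. 0) t s \<and> (0 < s 3 \<longleftrightarrow> eval ws \<phi> (sizes (prefix (ws ! 0))))"
      using t unfolding P_def n_def by (meson le_trans)
  qed (use assms in simp)
qed

section \<open>Certificates for the semantics\<close>

text \<open>What matters about ranks is that they are well-founded. On a finite set, irreflexivity
  together with transitivity ensures this, and both are first-order conditions.\<close>

definition defence_order :: "'a af \<Rightarrow> 'a set \<Rightarrow> ('a \<times> 'a) set \<Rightarrow> bool" where
  "defence_order F X L \<longleftrightarrow> irrefl L \<and> Relation.trans L \<and>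
     (\<forall>a\<in>X. \<forall>b. (b, a) \<in> atts F \<longrightarrow> (\<exists>c\<in>X. (c, b) \<in> atts F \<and> (c, a) \<in> L))"

lemma Gamma_mono: "S \<subseteq> T \<Longrightarrow> Gamma F S \<subseteq> Gamma F T"
  unfolding Gamma_def defends_def by blast

text \<open>Rank an argument by the first stage of the iteration of \<open>Gamma\<close> from the
  empty set that contains it: whatever enters at stage \<open>k + 1\<close> is defended by stage
  \<open>k\<close>. Finiteness is used to see that the union \<open>U\<close> of the stages is
  closed under \<open>Gamma\<close>: an argument has finitely many attackers, so one stage contains
  a counterattack on each. Then \<open>U\<close> is complete and included in \<open>X\<close>, hence
  equal to it by minimality.\<close>

lemma grounded_defence_order:
  assumes fin: "finite (atts F)" and X: "X \<in> grounded F"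
  shows "\<exists>L \<subseteq> X \<times> X. defence_order F X L"
proof -
  let ?G = "\<lambda>k. (Gamma F ^^ k) {}"
  define U where "U = (\<Union>k. ?G k)"
  have co: "X \<in> complete_ext F" and min: "\<And>T. T \<in> complete_ext F \<Longrightarrow> \<not> T \<subset> X"
    using X by (auto simp: grounded_def)
  have fix_X: "Gamma F X = X"
    using co by (auto simp: complete_ext_def admissible_def)
  have mono: "?G i \<subseteq> ?G j" if "i \<le> j" for i j
    by (rule funpow_mono2) (use that Gamma_mono in \<open>auto simp: mono_def\<close>)
  have GX: "?G k \<subseteq> X" for k
  proof (induction k)
    case (Suc k)
    then show ?case
      using Gamma_mono[of "?G k" X F] fix_X by simp
  qed simp
  then have UX: "U \<subseteq> X"
    unfolding U_def by blast
  have U1: "U \<subseteq> Gamma F U"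
  proof
    fix a assume "a \<in> U"
    then obtain k where "a \<in> ?G k"
      by (auto simp: U_def)
    then have "a \<in> Gamma F (?G k)"
      using mono[of k "Suc k"] by auto
    then show "a \<in> Gamma F U"
      using Gamma_mono[of "?G k" U F] by (auto simp: U_def)
  qed
  have U2: "Gamma F U \<subseteq> U"
  proof
    fix a assume a: "a \<in> Gamma F U"
    define B where "B = {b. (b, a) \<in> atts F}"
    have "B \<subseteq> fst ` atts F"
      by (force simp: B_def)
    then have finB: "finite B"
      using fin by (meson finite_imageI finite_subset)
    have "\<forall>b\<in>B. \<exists>k. \<exists>c \<in> ?G k. (c, b) \<in> atts F"
      using a by (force simp: B_def Gamma_def defends_def U_def)
    then obtain f where f: "\<And>b. b \<in> B \<Longrightarrow> \<exists>c \<in> ?G (f b). (c, b) \<in> atts F"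
      by metis
    \<comment> \<open>The sum is a convenient common bound for the stages \<open>f b\<close>, and it
      also makes sense when there are no attackers.\<close>
    have "f b \<le> sum f B" if "b \<in> B" for b
      using that finB by (simp add: member_le_sum)
    then have "\<exists>c \<in> ?G (sum f B). (c, b) \<in> atts F" if "b \<in> B" for b
      using f[OF that] mono[of "f b" "sum f B"] that by blast
    then have "a \<in> ?G (Suc (sum f B))"
      using a by (auto simp: Gamma_def defends_def B_def)
    then show "a \<in> U"
      unfolding U_def by blast
  qed
  have "U \<in> complete_ext F"
  proof -
    have "X \<subseteq> args F" "X \<inter> attacked_by F X = {}"
      using co unfolding complete_ext_def admissible_def conflict_free_def by blast+
    moreover have "attacked_by F U \<subseteq> attacked_by F X"
      using UX unfolding attacked_by_def by blast
    ultimately have "U \<subseteq> args F" "conflict_free F U"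
      using UX unfolding conflict_free_def by blast+
    then show ?thesis
      using U1 U2 unfolding complete_ext_def admissible_def by (intro CollectI conjI) assumption+
  qed
  then have "U = X"
    using min UX by blast
  then have XG: "\<exists>k. a \<in> ?G k" if "a \<in> X" for a
    using that unfolding U_def by blast
  define r where "r a = (LEAST k. a \<in> ?G k)" for a
  define L where "L = {(c, a). c \<in> X \<and> a \<in> X \<and> r c < r a}"
  have "\<exists>c\<in>X. (c, b) \<in> atts F \<and> (c, a) \<in> L" if a: "a \<in> X" and b: "(b, a) \<in> atts F" for a b
  proof -
    have ra: "a \<in> ?G (r a)"
      unfolding r_def using XG[OF a] by (rule LeastI_ex)
    then obtain k where k: "r a = Suc k"
      by (cases "r a") auto
    then have "a \<in> Gamma F (?G k)"
      using ra by simp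
    then obtain c where c: "c \<in> ?G k" "(c, b) \<in> atts F"
      using b by (auto simp: Gamma_def defends_def)
    then have "r c \<le> k"
      unfolding r_def by (intro Least_le)
    moreover have "c \<in> X"
      using c(1) GX by blast
    ultimately show ?thesis
      using c a k by (auto simp: L_def)
  qed
  moreover have "irrefl L" "Relation.trans L" "L \<subseteq> X \<times> X"
    by (auto simp: L_def irrefl_def Relation.trans_def)
  ultimately show ?thesis
    unfolding defence_order_def by blast
qed

text \<open>A complete proper subset would contain every element of the difference that is minimal for
  the order, since all of its defenders are smaller.\<close>

lemma defence_order_grounded:
  assumes "finite X" "X \<in> complete_ext F" and L: "defence_order F X L"
  shows "X \<in> grounded F"
proof -
  have False if T: "T \<in> complete_ext F" "T \<subset> X" for T
  proof -
    define L' where "L' = L \<inter> X \<times> X"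
    have "Relation.trans L'" "irrefl L'" "finite L'"
      using L assms(1) by (auto simp: L'_def defence_order_def Relation.trans_def irrefl_def)
    then have "wf L'"
      by (simp add: finite_acyclic_wf acyclic_irrefl)
    moreover obtain a0 where "a0 \<in> X - T"
      using T by blast
    ultimately obtain a where a: "a \<in> X - T" and min: "\<And>c. (c, a) \<in> L' \<Longrightarrow> c \<notin> X - T"
      using wfE_min[of L' a0 "X - T" thesis] by blast
    have "defends F T a"
      unfolding defends_def
    proof (intro allI impI)
      fix b assume "(b, a) \<in> atts F"
      then obtain c where "c \<in> X" "(c, b) \<in> atts F" "(c, a) \<in> L"
        using L a unfolding defence_order_def by blast
      then show "\<exists>c\<in>T. (c, b) \<in> atts F"
        using min[of c] a by (auto simp: L'_def)
    qed
    moreover have "a \<in> args F"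
      using a assms(2) by (auto simp: complete_ext_def admissible_def)
    ultimately show False
      using a T by (auto simp: complete_ext_def Gamma_def)
  qed
  then show ?thesis
    using assms(2) unfolding grounded_def by blast
qed

text \<open>\<open>L\<close> is the order for \<open>GR\<close> and \<open>V\<close> the challenger
  for \<open>PR\<close>. The common signature allows a single certificate layout for all
  semantics.\<close>

fun check_in :: "semantics \<Rightarrow> 'a af \<Rightarrow> 'a set \<Rightarrow> ('a \<times> 'a) set \<Rightarrow> 'a set \<Rightarrow> bool" where
  "check_in AD F X L V \<longleftrightarrow> X \<in> admissible F"
| "check_in ST F X L V \<longleftrightarrow> X \<in> stable F"
| "check_in CO F X L V \<longleftrightarrow> X \<in> complete_ext F"
| "check_in GR F X L V \<longleftrightarrow> X \<in> complete_ext F \<and> defence_order F X L"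
| "check_in PR F X L V \<longleftrightarrow> X \<in> admissible F \<and> \<not> (V \<in> admissible F \<and> X \<subset> V)"

fun check_out :: "semantics \<Rightarrow> 'a af \<Rightarrow> 'a set \<Rightarrow> 'a set \<Rightarrow> bool" where
  "check_out AD F X T \<longleftrightarrow> X \<notin> admissible F"
| "check_out ST F X T \<longleftrightarrow> X \<notin> stable F"
| "check_out CO F X T \<longleftrightarrow> X \<notin> complete_ext F"
| "check_out GR F X T \<longleftrightarrow> X \<notin> complete_ext F \<or> (T \<in> complete_ext F \<and> T \<subset> X)"
| "check_out PR F X T \<longleftrightarrow> X \<notin> admissible F \<or> (T \<in> admissible F \<and> X \<subset> T)"

text \<open>The sets range over a fixed universe \<open>U\<close> rather than over
  \<open>args F\<close>, because certificates are read relative to the arguments of the instance,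
  while \<open>args F\<close> depends on the guessed completion.\<close>

lemma extensions_check_in:
  assumes "finite U" "args F \<subseteq> U" "atts F \<subseteq> U \<times> U" "X \<subseteq> U"
  shows "X \<in> extensions j F \<longleftrightarrow> (\<exists>L \<subseteq> U \<times> U. \<forall>V \<subseteq> U. check_in j F X L V)"
proof -
  have vac: "\<exists>L. L \<subseteq> U \<times> U" "\<exists>V. V \<subseteq> U"
    by blast+
  have sub: "V \<subseteq> U" if "V \<in> admissible F" for V
    using that assms(2) by (auto simp: admissible_def)
  show ?thesis
  proof (cases j)
    case GR
    have fin: "finite (atts F)" "finite X"
      using assms by (auto intro: finite_subset[of _ "U \<times> U"] finite_subset[of _ U])
    show ?thesis
    proof
      assume X: "X \<in> extensions j F"
      then obtain L where "L \<subseteq> X \<times> X" "defence_order F X L"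
        using grounded_defence_order[OF fin(1), of X] GR by auto
      moreover have "X \<in> complete_ext F"
        using X GR by (simp add: grounded_def)
      moreover have "X \<times> X \<subseteq> U \<times> U"
        using assms(4) by blast
      ultimately show "\<exists>L \<subseteq> U \<times> U. \<forall>V \<subseteq> U. check_in j F X L V"
        using GR by (metis check_in.simps(4) subset_trans)
    next
      assume "\<exists>L \<subseteq> U \<times> U. \<forall>V \<subseteq> U. check_in j F X L V"
      then obtain L where "check_in j F X L {}"
        by blast
      then show "X \<in> extensions j F"
        using GR defence_order_grounded[OF fin(2)] by (simp, blast)
    qed
  next
    case PR
    have "X \<in> preferred F \<longleftrightarrow> (\<forall>V \<subseteq> U. X \<in> admissible F \<and> \<not> (V \<in> admissible F \<and> X \<subset> V))"
      using sub unfolding preferred_def by blast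
    then show ?thesis
      using PR by (simp add: vac)
  qed (simp_all add: vac)
qed

lemma extensions_check_out:
  assumes "args F \<subseteq> U"
  shows "X \<notin> extensions j F \<longleftrightarrow> (\<exists>T \<subseteq> U. check_out j F X T)"
proof -
  have vac: "\<exists>T. T \<subseteq> U"
    by blast
  have sub: "T \<subseteq> U" if "T \<in> admissible F" for T
    using that assms by (auto simp: admissible_def)
  then have sub': "T \<subseteq> U" if "T \<in> complete_ext F" for T
    using that by (auto simp: complete_ext_def)
  show ?thesis
  proof (cases j)
    case GR
    then show ?thesis
      using sub' by (simp add: grounded_def) blast
  next
    case PR
    then show ?thesis
      using sub by (simp add: preferred_def) blast
  qed (simp_all add: vac)
qed

section \<open>Relevance in terms of a guessed completion\<close>

definition with_element :: "'a set \<Rightarrow> ('a \<times> 'a) set \<Rightarrow> 'a set \<Rightarrow> ('a \<times> 'a) set \<Rightarrow> 'a af" where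
  "with_element A' R' E1 E2 =
     \<lparr>args = A' \<union> E1, atts = (R' \<union> E2) \<inter> (A' \<union> E1) \<times> (A' \<union> E1)\<rparr>"

definition without_element :: "'a set \<Rightarrow> ('a \<times> 'a) set \<Rightarrow> 'a af" where
  "without_element A' R' = \<lparr>args = A', atts = R' \<inter> A' \<times> A'\<rparr>"

definition completion ::
  "'a set \<Rightarrow> ('a \<times> 'a) set \<Rightarrow> ('a \<times> 'a) set \<Rightarrow> 'a set \<Rightarrow> ('a \<times> 'a) set \<Rightarrow>
     'a set \<Rightarrow> ('a \<times> 'a) set \<Rightarrow> bool" where
  "completion C R Q E1 E2 A' R' \<longleftrightarrow>
     A' \<inter> E1 = {} \<and> R' \<inter> E2 = {} \<and> C \<subseteq> A' \<and> R' \<subseteq> R \<union> Q \<and>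
     R' \<subseteq> (A' \<union> E1) \<times> (A' \<union> E1) \<and> E2 \<subseteq> (A' \<union> E1) \<times> (A' \<union> E1) \<and>
     R \<inter> (A' \<union> E1) \<times> (A' \<union> E1) \<subseteq> R'"

text \<open>A partial completion whose only uncertain element is \<open>e\<close> is determined by
  its certain arguments and attacks. Attacks deleted together with an argument \<open>e\<close> lie
  outside \<open>A' \<times> A'\<close> anyway. Changing the action or changing the truth value of
  the status exchanges the roles of the two frameworks, so four cases collapse into two.\<close>

lemma relevant_iff:
  assumes e: "e \<in> uncertain I" and E: "E1 = {a. e = Inl a}" "E2 = {r. e = Inr r}"
  shows "relevant (j, b) act e S I \<longleftrightarrow>
    (\<exists>A' R'. A' \<subseteq> cert_args I \<union> unc_args I \<and>
       completion (cert_args I) (cert_atts I) (unc_atts I) E1 E2 A' R' \<and>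
       (if (act = Addition) = b
        then S \<in> extensions j (with_element A' R' E1 E2) \<and> S \<notin> extensions j (without_element A' R')
        else S \<in> extensions j (without_element A' R') \<and> S \<notin> extensions j (with_element A' R' E1 E2)))"
    (is "_ \<longleftrightarrow> (\<exists>A' R'. ?P A' R')")
proof -
  define J where "J A' R' = \<lparr>cert_args = A', unc_args = E1, cert_atts = R', unc_atts = E2\<rparr>" for A' R'
  have unc: "uncertain I' = {e} \<longleftrightarrow> unc_args I' = E1 \<and> unc_atts I' = E2" for I'
    unfolding E uncertain_def by (cases e) (auto simp: Plus_def)
  have J: "I' = J (cert_args I') (cert_atts I')" if "uncertain I' = {e}" for I'
    using that unc[of I'] by (simp add: J_def)
  have E': "E1 \<subseteq> unc_args I" "E2 \<subseteq> unc_atts I"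
    using e by (auto simp: E uncertain_def)
  have part: "J A' R' \<in> part I \<longleftrightarrow> A' \<subseteq> cert_args I \<union> unc_args I \<and>
      completion (cert_args I) (cert_atts I) (unc_atts I) E1 E2 A' R'" for A' R'
    using E' by (auto simp: part_def is_iaf_def completion_def J_def)
  have add: "cert (add_element (J A' R') e) = with_element A' R' E1 E2" for A' R'
    by (cases e) (auto simp: E J_def cert_def add_args_def add_atts_def with_element_def)
  have rem: "cert (remove_element (J A' R') e) = without_element A' R'"
    if "J A' R' \<in> part I" for A' R'
    using that unfolding part
    by (cases e)
      (auto simp: E J_def cert_def remove_args_def remove_atts_def without_element_def
        completion_def Let_def)
  have *: "?P A' R' \<longleftrightarrow> J A' R' \<in> part I \<and> has_status (j, b) (cert (perform act (J A' R') e)) S \<and>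
      \<not> has_status (j, b) (cert (perform (opposite act) (J A' R') e)) S" for A' R'
  proof (cases "J A' R' \<in> part I")
    case True
    then show ?thesis
      using part[of A' R'] by (cases act; cases b) (auto simp: add rem has_status_def)
  next
    case False
    then show ?thesis
      using part[of A' R'] by blast
  qed
  have "uncertain (J A' R') = {e}" for A' R'
    by (simp add: unc) (simp add: J_def)
  then show ?thesis
    unfolding relevant_def * using J by metis
qed

section \<open>Evaluating the semantics by formulas\<close>

lemma bound_vars_ge: "wf_fm m \<phi> \<Longrightarrow> v \<in> bound_vars \<phi> \<Longrightarrow> 2 \<le> v"
  by (induction \<phi>) auto

lemma NP_I:
  assumes "wf_fm 2 \<phi>"
    and "\<And>x. x \<in> L \<longleftrightarrow> (\<exists>u. length u \<le> length x \<and> eval [x, u] \<phi> (sizes (prefix x)))"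
  shows "L \<in> NP"
proof -
  have "poly_time_decidable 2 (\<lambda>ws. eval ws \<phi> (sizes (prefix (ws ! 0))))"
    using assms(1) bound_vars_ge[OF assms(1), of 0] bound_vars_ge[OF assms(1), of 1]
    by (intro poly_time_decidable_fm) auto
  then show ?thesis
    unfolding NP_def using assms(2)
    by (intro CollectI exI[of _ "\<lambda>ws. eval ws \<phi> (sizes (prefix (ws ! 0)))"] exI[of _ pX]) simp
qed

lemma Sigma2P_I:
  assumes "wf_fm 3 \<phi>"
    and "\<And>x. x \<in> L \<longleftrightarrow> (\<exists>u. length u \<le> length x \<and>
      (\<forall>v. length v \<le> length x \<longrightarrow> eval [x, u, v] \<phi> (sizes (prefix x))))"
  shows "L \<in> Sigma2P"
proof -
  have "poly_time_decidable 3 (\<lambda>ws. eval ws \<phi> (sizes (prefix (ws ! 0))))"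
    using assms(1) bound_vars_ge[OF assms(1), of 0] bound_vars_ge[OF assms(1), of 1]
    by (intro poly_time_decidable_fm) auto
  then show ?thesis
    unfolding Sigma2P_def using assms(2)
    by (intro CollectI exI[of _ "\<lambda>ws. eval ws \<phi> (sizes (prefix (ws ! 0)))"] exI[of _ pX]) simp
qed

section \<open>Addressing cells, and sets denoted by formulas\<close>

abbreviation Imp :: "fm \<Rightarrow> fm \<Rightarrow> fm" where "Imp a b \<equiv> Neg (Conj a (Neg b))"
abbreviation Disj :: "fm \<Rightarrow> fm \<Rightarrow> fm" where "Disj a b \<equiv> Neg (Conj (Neg a) (Neg b))"
abbreviation Ex :: "nat \<Rightarrow> fm \<Rightarrow> fm" where "Ex v a \<equiv> Neg (All v (Neg a))"

fun scale :: "nat \<Rightarrow> trm \<Rightarrow> trm" where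
  "scale 0 t = Zero"
| "scale (Suc k) t = Plus t (scale k t)"

lemma scale_simps [simp]:
  "tval (scale k t) e = k * tval t e" "wf_trm t \<Longrightarrow> wf_trm (scale k t)"
  by (induction k) auto

text \<open>The address of an entry behind \<open>c\<close> single bits, \<open>l\<close>
  characteristic vectors and \<open>q\<close> adjacency matrices. The square of the size is a
  product of variables 0 and 1.\<close>

definition pos :: "nat \<Rightarrow> nat \<Rightarrow> nat \<Rightarrow> trm \<Rightarrow> trm" where
  "pos c l q t =
     Plus (scale c One) (Plus (scale l (Times 0 One)) (Plus (scale q (Times 0 (Times 1 One))) t))"

lemma pos_simps [simp]:
  "tval (pos c l q t) e = c + l * e 0 + q * (e 0 * e 1) + tval t e"
  "wf_trm (pos c l q t) \<longleftrightarrow> wf_trm t"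
  by (auto simp: pos_def)

definition unary :: "nat \<Rightarrow> nat \<Rightarrow> nat \<Rightarrow> nat \<Rightarrow> nat \<Rightarrow> fm" where
  "unary k c l q v = Sym k 2 (pos c l q (Times v One))"

definition binary :: "nat \<Rightarrow> nat \<Rightarrow> nat \<Rightarrow> nat \<Rightarrow> nat \<Rightarrow> nat \<Rightarrow> fm" where
  "binary k c l q v w = Sym k 2 (pos c l q (Plus (Times v (Times 0 One)) (Times w One)))"

lemma wf_atoms [simp]:
  "wf_fm m (unary k c l q v) \<longleftrightarrow> k < m" "bound_vars (unary k c l q v) = {}"
  "2 \<le> v \<Longrightarrow> wf_fm m (binary k c l q v w) \<longleftrightarrow> k < m" "bound_vars (binary k c l q v w) = {}"
  by (auto simp: unary_def binary_def)

definition bit_at :: "bool list \<Rightarrow> nat \<Rightarrow> bool" where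
  "bit_at w i \<longleftrightarrow> i < length w \<and> w ! i"

lemma symbol_eq_2: "symbol w i = 2 \<longleftrightarrow> bit_at w i"
  by (simp add: symbol_def bit_at_def)

text \<open>Formulas quantify over indices, the semantics over arguments; the enumeration
  \<open>xs\<close> connects the two. All environments with the right sizes are covered because
  quantifiers rebind variables. Since \<open>A\<close> is any function of a variable, compound
  formulas can denote sets as well as atoms do.\<close>

definition denotes1 :: "bool list list \<Rightarrow> 'a list \<Rightarrow> (nat \<Rightarrow> fm) \<Rightarrow> 'a set \<Rightarrow> bool" where
  "denotes1 ws xs A X \<longleftrightarrow>
     (\<forall>e v. e 0 = length xs \<longrightarrow> e 1 = length xs \<longrightarrow> 2 \<le> v \<longrightarrow> e v < length xs \<longrightarrow>
        (eval ws (A v) e \<longleftrightarrow> xs ! e v \<in> X))"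

definition denotes2 :: "bool list list \<Rightarrow> 'a list \<Rightarrow> (nat \<Rightarrow> nat \<Rightarrow> fm) \<Rightarrow> ('a \<times> 'a) set \<Rightarrow> bool" where
  "denotes2 ws xs R Y \<longleftrightarrow>
     (\<forall>e v w. e 0 = length xs \<longrightarrow> e 1 = length xs \<longrightarrow> 2 \<le> v \<longrightarrow> 2 \<le> w \<longrightarrow>
        e v < length xs \<longrightarrow> e w < length xs \<longrightarrow>
        (eval ws (R v w) e \<longleftrightarrow> (xs ! e v, xs ! e w) \<in> Y))"

lemma denotes1D:
  "denotes1 ws xs A X \<Longrightarrow> e 0 = length xs \<Longrightarrow> e (Suc 0) = length xs \<Longrightarrow> 2 \<le> v \<Longrightarrow> e v < length xs \<Longrightarrow>
     eval ws (A v) e \<longleftrightarrow> xs ! e v \<in> X"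
  by (simp add: denotes1_def)

lemma denotes2D:
  "denotes2 ws xs R Y \<Longrightarrow> e 0 = length xs \<Longrightarrow> e (Suc 0) = length xs \<Longrightarrow> 2 \<le> v \<Longrightarrow> 2 \<le> w \<Longrightarrow>
     e v < length xs \<Longrightarrow> e w < length xs \<Longrightarrow> eval ws (R v w) e \<longleftrightarrow> (xs ! e v, xs ! e w) \<in> Y"
  by (simp add: denotes2_def)

lemma bit_at_block:
  "i < length ys \<Longrightarrow> bit_at (pre @ map P ys @ post) (length pre + i) \<longleftrightarrow> P (ys ! i)"
  by (simp add: bit_at_def nth_append)

lemma pair_index_less:
  fixes i j n :: nat
  assumes "i < n" "j < n"
  shows "i * n + j < n * n"
proof -
  have "i * n + j < Suc i * n"
    using assms by simp
  also have "\<dots> \<le> n * n"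
    using assms by (intro mult_le_mono1) simp
  finally show ?thesis .
qed

lemma nth_product_pair:
  assumes "i < length xs" "j < length xs"
  shows "List.product xs xs ! (i * length xs + j) = (xs ! i, xs ! j)"
proof -
  have "0 < length xs"
    using assms by linarith
  then show ?thesis
    using product_nth[OF pair_index_less[OF assms]] assms by simp
qed

lemma denotes_unary:
  assumes "ws ! k = pre @ map (\<lambda>a. a \<in> X) xs @ post"
    and "length pre = c + l * length xs + q * (length xs * length xs)"
  shows "denotes1 ws xs (unary k c l q) X"
  using assms by (auto simp: denotes1_def unary_def symbol_eq_2 bit_at_block simp flip: assms(2))

lemma denotes_binary:
  assumes "ws ! k = pre @ map (\<lambda>r. r \<in> Y) (List.product xs xs) @ post"
    and "length pre = c + l * length xs + q * (length xs * length xs)"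
  shows "denotes2 ws xs (binary k c l q) Y"
  using assms
  by (auto simp: denotes2_def binary_def symbol_eq_2 bit_at_block pair_index_less nth_product_pair
      simp flip: assms(2))

text \<open>Cells past the end are blank and count as absent, so a certificate of any length denotes
  some set. That set depends on the word \<open>w\<close> alone, not on the other tapes, so sets
  read from the existential certificate are fixed before the universal one is chosen.\<close>

lemma denotes_unary_ex:
  assumes "distinct xs"
  shows "\<exists>X \<subseteq> set xs. \<forall>ws. ws ! k = w \<longrightarrow> denotes1 ws xs (unary k c l q) X"
proof -
  let ?o = "c + l * length xs + q * (length xs * length xs)"
  let ?X = "{xs ! i | i. i < length xs \<and> bit_at w (?o + i)}"
  have "xs ! i \<in> ?X \<longleftrightarrow> bit_at w (?o + i)" if "i < length xs" for i
    using that assms by (auto simp: nth_eq_iff_index_eq)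
  then show ?thesis
    by (intro exI[of _ ?X]) (auto simp: denotes1_def unary_def symbol_eq_2)
qed

lemma denotes_binary_ex:
  assumes "distinct xs"
  shows "\<exists>Y \<subseteq> set xs \<times> set xs. \<forall>ws. ws ! k = w \<longrightarrow> denotes2 ws xs (binary k c l q) Y"
proof -
  let ?o = "c + l * length xs + q * (length xs * length xs)"
  let ?Y = "{(xs ! i, xs ! j) | i j. i < length xs \<and> j < length xs \<and>
    bit_at w (?o + (i * length xs + j))}"
  have "(xs ! i, xs ! j) \<in> ?Y \<longleftrightarrow> bit_at w (?o + (i * length xs + j))"
    if "i < length xs" "j < length xs" for i j
    using that assms by (auto simp: nth_eq_iff_index_eq)
  then show ?thesis
    by (intro exI[of _ ?Y]) (auto simp: denotes2_def binary_def symbol_eq_2)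
qed

lemma block_ex:
  assumes "distinct ys" "length b = length ys"
  shows "\<exists>Y \<subseteq> set ys. b = map (\<lambda>a. a \<in> Y) ys"
  by (rule exI[of _ "{ys ! i | i. i < length ys \<and> b ! i}"])
    (use assms in \<open>auto simp: nth_eq_iff_index_eq intro!: nth_equalityI\<close>)

section \<open>First-order formulas for the semantics\<close>

definition subset_fm :: "(nat \<Rightarrow> fm) \<Rightarrow> (nat \<Rightarrow> fm) \<Rightarrow> fm" where
  "subset_fm A B = All 2 (Imp (A 2) (B 2))"

definition subrel_fm :: "(nat \<Rightarrow> nat \<Rightarrow> fm) \<Rightarrow> (nat \<Rightarrow> nat \<Rightarrow> fm) \<Rightarrow> fm" where
  "subrel_fm R Q = All 2 (All 3 (Imp (R 2 3) (Q 2 3)))"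

definition conflict_free_fm :: "(nat \<Rightarrow> nat \<Rightarrow> fm) \<Rightarrow> (nat \<Rightarrow> fm) \<Rightarrow> fm" where
  "conflict_free_fm R S = All 2 (All 3 (Neg (Conj (Conj (S 2) (S 3)) (R 2 3))))"

definition defends_fm :: "(nat \<Rightarrow> nat \<Rightarrow> fm) \<Rightarrow> (nat \<Rightarrow> fm) \<Rightarrow> fm" where
  "defends_fm R S = All 3 (Imp (R 3 2) (Ex 4 (Conj (S 4) (R 4 3))))"

definition admissible_fm :: "(nat \<Rightarrow> fm) \<Rightarrow> (nat \<Rightarrow> nat \<Rightarrow> fm) \<Rightarrow> (nat \<Rightarrow> fm) \<Rightarrow> fm" where
  "admissible_fm A R S =
     Conj (subset_fm S A) (Conj (conflict_free_fm R S) (All 2 (Imp (S 2) (defends_fm R S))))"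

definition complete_fm :: "(nat \<Rightarrow> fm) \<Rightarrow> (nat \<Rightarrow> nat \<Rightarrow> fm) \<Rightarrow> (nat \<Rightarrow> fm) \<Rightarrow> fm" where
  "complete_fm A R S =
     Conj (admissible_fm A R S) (All 2 (Imp (Conj (A 2) (defends_fm R S)) (S 2)))"

text \<open>Given conflict-freeness, the equation for the attacked set splits into two parts:
  attacks from \<open>S\<close> end in \<open>A\<close>, and every argument of \<open>A\<close>
  outside \<open>S\<close> is attacked.\<close>

definition stable_fm :: "(nat \<Rightarrow> fm) \<Rightarrow> (nat \<Rightarrow> nat \<Rightarrow> fm) \<Rightarrow> (nat \<Rightarrow> fm) \<Rightarrow> fm" where
  "stable_fm A R S =
     Conj (subset_fm S A) (Conj (conflict_free_fm R S)
       (Conj (subrel_fm (\<lambda>v w. Conj (S v) (R v w)) (\<lambda>v w. A w))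
         (All 2 (Imp (Conj (A 2) (Neg (S 2))) (Ex 3 (Conj (S 3) (R 3 2)))))))"

definition order_fm :: "(nat \<Rightarrow> nat \<Rightarrow> fm) \<Rightarrow> (nat \<Rightarrow> fm) \<Rightarrow> (nat \<Rightarrow> nat \<Rightarrow> fm) \<Rightarrow> fm" where
  "order_fm R S L =
     Conj (All 2 (Neg (L 2 2)))
       (Conj (All 2 (All 3 (All 4 (Imp (Conj (L 2 3) (L 3 4)) (L 2 4)))))
         (All 2 (All 3 (Imp (Conj (S 2) (R 3 2)) (Ex 4 (Conj (S 4) (Conj (R 4 3) (L 4 2))))))))"

definition psubset_fm :: "(nat \<Rightarrow> fm) \<Rightarrow> (nat \<Rightarrow> fm) \<Rightarrow> fm" where
  "psubset_fm A B = Conj (subset_fm A B) (Neg (subset_fm B A))"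

fun in_fm :: "semantics \<Rightarrow> (nat \<Rightarrow> fm) \<Rightarrow> (nat \<Rightarrow> nat \<Rightarrow> fm) \<Rightarrow> (nat \<Rightarrow> fm) \<Rightarrow>
    (nat \<Rightarrow> nat \<Rightarrow> fm) \<Rightarrow> (nat \<Rightarrow> fm) \<Rightarrow> fm" where
  "in_fm AD A R S L V = admissible_fm A R S"
| "in_fm ST A R S L V = stable_fm A R S"
| "in_fm CO A R S L V = complete_fm A R S"
| "in_fm GR A R S L V = Conj (complete_fm A R S) (order_fm R S L)"
| "in_fm PR A R S L V =
     Conj (admissible_fm A R S) (Neg (Conj (admissible_fm A R V) (psubset_fm S V)))"

fun out_fm :: "semantics \<Rightarrow> (nat \<Rightarrow> fm) \<Rightarrow> (nat \<Rightarrow> nat \<Rightarrow> fm) \<Rightarrow> (nat \<Rightarrow> fm) \<Rightarrow> (nat \<Rightarrow> fm) \<Rightarrow> fm" where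
  "out_fm AD A R S T = Neg (admissible_fm A R S)"
| "out_fm ST A R S T = Neg (stable_fm A R S)"
| "out_fm CO A R S T = Neg (complete_fm A R S)"
| "out_fm GR A R S T = Disj (Neg (complete_fm A R S)) (Conj (complete_fm A R T) (psubset_fm T S))"
| "out_fm PR A R S T = Disj (Neg (admissible_fm A R S)) (Conj (admissible_fm A R T) (psubset_fm S T))"

context
  fixes ws :: "bool list list" and xs :: "'a list" and e :: "nat \<Rightarrow> nat"
  assumes e: "e 0 = length xs" "e (Suc 0) = length xs"
begin

lemma eval_subset_fm:
  assumes "denotes1 ws xs A X" "denotes1 ws xs B Y" "X \<subseteq> set xs"
  shows "eval ws (subset_fm A B) e \<longleftrightarrow> X \<subseteq> Y"
proof -
  have "X \<subseteq> Y \<longleftrightarrow> (\<forall>a\<in>set xs. a \<in> X \<longrightarrow> a \<in> Y)"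
    using assms(3) by blast
  then show ?thesis
    using assms e by (auto simp: subset_fm_def all_set_conv_all_nth denotes1D)
qed

lemma eval_subrel_fm:
  assumes "denotes2 ws xs R X" "denotes2 ws xs Q Y" "X \<subseteq> set xs \<times> set xs"
  shows "eval ws (subrel_fm R Q) e \<longleftrightarrow> X \<subseteq> Y"
proof -
  have "X \<subseteq> Y \<longleftrightarrow> (\<forall>a\<in>set xs. \<forall>b\<in>set xs. (a, b) \<in> X \<longrightarrow> (a, b) \<in> Y)"
    using assms(3) by blast
  then show ?thesis
    using assms e by (auto simp: subrel_fm_def all_set_conv_all_nth denotes2D)
qed

lemma eval_psubset_fm:
  assumes "denotes1 ws xs A X" "denotes1 ws xs B Y" "X \<subseteq> set xs" "Y \<subseteq> set xs"
  shows "eval ws (psubset_fm A B) e \<longleftrightarrow> X \<subset> Y"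
  using assms by (auto simp: psubset_fm_def eval_subset_fm)

lemma eval_conflict_free_fm:
  assumes "denotes2 ws xs R (atts F)" "denotes1 ws xs S X" "X \<subseteq> set xs"
  shows "eval ws (conflict_free_fm R S) e \<longleftrightarrow> conflict_free F X"
proof -
  have "conflict_free F X \<longleftrightarrow> (\<forall>a\<in>set xs. \<forall>b\<in>set xs. \<not> (a \<in> X \<and> b \<in> X \<and> (a, b) \<in> atts F))"
    using assms(3) unfolding conflict_free_def attacked_by_def by blast
  then show ?thesis
    using assms e by (auto simp: conflict_free_fm_def all_set_conv_all_nth denotes1D denotes2D)
qed

lemma eval_defends_fm:
  assumes "denotes2 ws xs R (atts F)" "denotes1 ws xs S X" "X \<subseteq> set xs"
    and "atts F \<subseteq> set xs \<times> set xs" "i < length xs"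
  shows "eval ws (defends_fm R S) (e(2 := i)) \<longleftrightarrow> defends F X (xs ! i)"
proof -
  have "defends F X (xs ! i) \<longleftrightarrow> (\<forall>b\<in>set xs. (b, xs ! i) \<in> atts F \<longrightarrow>
      \<not> (\<forall>c\<in>set xs. \<not> (c \<in> X \<and> (c, b) \<in> atts F)))"
    using assms(3,4) unfolding defends_def by blast
  then show ?thesis
    using assms e by (auto simp: defends_fm_def all_set_conv_all_nth denotes1D denotes2D)
qed

lemma eval_admissible_fm:
  assumes "denotes1 ws xs A (args F)" "denotes2 ws xs R (atts F)" "denotes1 ws xs S X"
    and "X \<subseteq> set xs" "args F \<subseteq> set xs" "atts F \<subseteq> set xs \<times> set xs"
  shows "eval ws (admissible_fm A R S) e \<longleftrightarrow> X \<in> admissible F"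
proof -
  have "X \<in> admissible F \<longleftrightarrow>
      X \<subseteq> args F \<and> conflict_free F X \<and> (\<forall>a\<in>set xs. a \<in> X \<longrightarrow> defends F X a)"
    using assms(4) unfolding admissible_def Gamma_def by blast
  then show ?thesis
    using assms e
    by (simp add: admissible_fm_def eval_subset_fm eval_conflict_free_fm eval_defends_fm
        all_set_conv_all_nth denotes1D)
qed

lemma eval_complete_fm:
  assumes "denotes1 ws xs A (args F)" "denotes2 ws xs R (atts F)" "denotes1 ws xs S X"
    and "X \<subseteq> set xs" "args F \<subseteq> set xs" "atts F \<subseteq> set xs \<times> set xs"
  shows "eval ws (complete_fm A R S) e \<longleftrightarrow> X \<in> complete_ext F"
proof -
  have "X \<in> complete_ext F \<longleftrightarrow>
      X \<in> admissible F \<and> (\<forall>a\<in>set xs. a \<in> args F \<and> defends F X a \<longrightarrow> a \<in> X)"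
    using assms(5) unfolding complete_ext_def Gamma_def by blast
  then show ?thesis
    using assms e
    by (simp add: complete_fm_def eval_admissible_fm eval_defends_fm all_set_conv_all_nth denotes1D) blast
qed

lemma eval_stable_fm:
  assumes "denotes1 ws xs A (args F)" "denotes2 ws xs R (atts F)" "denotes1 ws xs S X"
    and "X \<subseteq> set xs" "args F \<subseteq> set xs" "atts F \<subseteq> set xs \<times> set xs"
  shows "eval ws (stable_fm A R S) e \<longleftrightarrow> X \<in> stable F"
proof -
  let ?att = "\<forall>a\<in>set xs. \<forall>b\<in>set xs. a \<in> X \<and> (a, b) \<in> atts F \<longrightarrow> b \<in> args F"
  let ?out = "\<forall>b\<in>set xs. b \<in> args F \<and> b \<notin> X \<longrightarrow> \<not> (\<forall>a\<in>set xs. \<not> (a \<in> X \<and> (a, b) \<in> atts F))"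
  have "X \<in> stable F \<longleftrightarrow> X \<subseteq> args F \<and> conflict_free F X \<and> ?att \<and> ?out"
    using assms(4,5,6) unfolding stable_def conflict_free_def attacked_by_def by blast
  moreover have "eval ws (subrel_fm (\<lambda>v w. Conj (S v) (R v w)) (\<lambda>v w. A w)) e \<longleftrightarrow> ?att"
    using assms e by (auto simp: subrel_fm_def all_set_conv_all_nth denotes1D denotes2D)
  moreover have "eval ws (All 2 (Imp (Conj (A 2) (Neg (S 2))) (Ex 3 (Conj (S 3) (R 3 2))))) e \<longleftrightarrow> ?out"
    using assms e by (auto simp: all_set_conv_all_nth denotes1D denotes2D)
  ultimately show ?thesis
    using assms unfolding stable_fm_def
    by (simp add: eval_subset_fm eval_conflict_free_fm)
qed

lemma eval_order_fm:
  assumes "denotes2 ws xs R (atts F)" "denotes1 ws xs S X" "denotes2 ws xs L Y"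
    and "X \<subseteq> set xs" "atts F \<subseteq> set xs \<times> set xs" "Y \<subseteq> set xs \<times> set xs"
  shows "eval ws (order_fm R S L) e \<longleftrightarrow> defence_order F X Y"
proof -
  have *: "defence_order F X Y \<longleftrightarrow> (\<forall>a\<in>set xs. (a, a) \<notin> Y) \<and>
      (\<forall>a\<in>set xs. \<forall>b\<in>set xs. \<forall>c\<in>set xs. (b, c) \<in> Y \<longrightarrow> (a, b) \<in> Y \<longrightarrow> (a, c) \<in> Y) \<and>
      (\<forall>a\<in>set xs. \<forall>b\<in>set xs. a \<in> X \<and> (b, a) \<in> atts F \<longrightarrow>
         \<not> (\<forall>c\<in>set xs. \<not> (c \<in> X \<and> (c, b) \<in> atts F \<and> (c, a) \<in> Y)))"
    (is "_ \<longleftrightarrow> ?irr \<and> ?tr \<and> ?def")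
  proof -
    have "irrefl Y \<longleftrightarrow> ?irr"
      using assms(6) unfolding irrefl_def by blast
    moreover have "Relation.trans Y \<longleftrightarrow> ?tr"
      using assms(6) unfolding Relation.trans_def by blast
    moreover have "(\<forall>a\<in>X. \<forall>b. (b, a) \<in> atts F \<longrightarrow> (\<exists>c\<in>X. (c, b) \<in> atts F \<and> (c, a) \<in> Y)) \<longleftrightarrow> ?def"
      using assms(4,5) by blast
    ultimately show ?thesis
      unfolding defence_order_def by simp
  qed
  show ?thesis
  proof -
    have "eval ws (All 2 (Neg (L 2 2))) e \<longleftrightarrow> ?irr"
      using assms e by (simp add: all_set_conv_all_nth denotes2D)
    moreover have "eval ws (All 2 (All 3 (All 4 (Imp (Conj (L 2 3) (L 3 4)) (L 2 4))))) e \<longleftrightarrow> ?tr"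
      using assms e by (simp add: all_set_conv_all_nth denotes2D)
    moreover have "eval ws (All 2 (All 3 (Imp (Conj (S 2) (R 3 2))
        (Ex 4 (Conj (S 4) (Conj (R 4 3) (L 4 2))))))) e \<longleftrightarrow> ?def"
      using assms e by (simp add: all_set_conv_all_nth denotes1D denotes2D) meson
    ultimately show ?thesis
      using * unfolding order_fm_def by simp
  qed
qed

lemma eval_in_fm:
  assumes "denotes1 ws xs A (args F)" "denotes2 ws xs R (atts F)" "denotes1 ws xs S X"
    "denotes2 ws xs L Y" "denotes1 ws xs V Z"
    and "X \<subseteq> set xs" "args F \<subseteq> set xs" "atts F \<subseteq> set xs \<times> set xs" "Y \<subseteq> set xs \<times> set xs" "Z \<subseteq> set xs"
  shows "eval ws (in_fm j A R S L V) e \<longleftrightarrow> check_in j F X Y Z"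
  using assms
  by (cases j)
    (simp_all add: eval_admissible_fm eval_stable_fm eval_complete_fm eval_order_fm eval_psubset_fm)

lemma eval_out_fm:
  assumes "denotes1 ws xs A (args F)" "denotes2 ws xs R (atts F)" "denotes1 ws xs S X"
    "denotes1 ws xs T Z"
    and "X \<subseteq> set xs" "args F \<subseteq> set xs" "atts F \<subseteq> set xs \<times> set xs" "Z \<subseteq> set xs"
  shows "eval ws (out_fm j A R S T) e \<longleftrightarrow> check_out j F X Z"
  using assms
  by (cases j)
    (auto simp add: eval_admissible_fm eval_stable_fm eval_complete_fm eval_psubset_fm)

end

section \<open>Words of instances\<close>

lemma denotes1_Disj:
  "denotes1 ws xs A X \<Longrightarrow> denotes1 ws xs B Y \<Longrightarrow> denotes1 ws xs (\<lambda>v. Disj (A v) (B v)) (X \<union> Y)"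
  by (auto simp: denotes1_def)

lemma denotes2_Disj:
  "denotes2 ws xs A X \<Longrightarrow> denotes2 ws xs B Y \<Longrightarrow> denotes2 ws xs (\<lambda>v w. Disj (A v w) (B v w)) (X \<union> Y)"
  by (auto simp: denotes2_def)

lemma denotes2_Conj:
  "denotes2 ws xs A X \<Longrightarrow> denotes2 ws xs B Y \<Longrightarrow> denotes2 ws xs (\<lambda>v w. Conj (A v w) (B v w)) (X \<inter> Y)"
  by (auto simp: denotes2_def)

lemma denotes2_square:
  "denotes1 ws xs A X \<Longrightarrow> denotes2 ws xs (\<lambda>v w. Conj (A v) (A w)) (X \<times> X)"
  by (auto simp: denotes1_def denotes2_def)

definition disjoint1_fm :: "(nat \<Rightarrow> fm) \<Rightarrow> (nat \<Rightarrow> fm) \<Rightarrow> fm" where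
  "disjoint1_fm A B = All 2 (Neg (Conj (A 2) (B 2)))"

definition disjoint2_fm :: "(nat \<Rightarrow> nat \<Rightarrow> fm) \<Rightarrow> (nat \<Rightarrow> nat \<Rightarrow> fm) \<Rightarrow> fm" where
  "disjoint2_fm A B = All 2 (All 3 (Neg (Conj (A 2 3) (B 2 3))))"

lemma eval_disjoint1_fm:
  assumes "e 0 = length xs" "e (Suc 0) = length xs"
    and "denotes1 ws xs A X" "denotes1 ws xs B Y" "X \<subseteq> set xs"
  shows "eval ws (disjoint1_fm A B) e \<longleftrightarrow> X \<inter> Y = {}"
proof -
  have "X \<inter> Y = {} \<longleftrightarrow> (\<forall>a\<in>set xs. a \<in> X \<longrightarrow> a \<notin> Y)"
    using assms(5) by blast
  then show ?thesis
    using assms by (auto simp: disjoint1_fm_def all_set_conv_all_nth denotes1D)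
qed

lemma eval_disjoint2_fm:
  assumes "e 0 = length xs" "e (Suc 0) = length xs"
    and "denotes2 ws xs A X" "denotes2 ws xs B Y" "X \<subseteq> set xs \<times> set xs"
  shows "eval ws (disjoint2_fm A B) e \<longleftrightarrow> X \<inter> Y = {}"
proof -
  have "X \<inter> Y = {} \<longleftrightarrow> (\<forall>a\<in>set xs. \<forall>b\<in>set xs. (a, b) \<in> X \<longrightarrow> (a, b) \<notin> Y)"
    using assms(5) by blast
  then show ?thesis
    using assms by (auto simp: disjoint2_fm_def all_set_conv_all_nth denotes2D)
qed

definition completion_fm ::
  "(nat \<Rightarrow> fm) \<Rightarrow> (nat \<Rightarrow> nat \<Rightarrow> fm) \<Rightarrow> (nat \<Rightarrow> nat \<Rightarrow> fm) \<Rightarrow> (nat \<Rightarrow> fm) \<Rightarrow> (nat \<Rightarrow> nat \<Rightarrow> fm) \<Rightarrow>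
     (nat \<Rightarrow> fm) \<Rightarrow> (nat \<Rightarrow> nat \<Rightarrow> fm) \<Rightarrow> fm" where
  "completion_fm C R Q E1 E2 A' R' =
     (let sq = (\<lambda>v w. Conj (Disj (A' v) (E1 v)) (Disj (A' w) (E1 w)))
      in Conj (disjoint1_fm A' E1) (Conj (disjoint2_fm R' E2) (Conj (subset_fm C A')
        (Conj (subrel_fm R' (\<lambda>v w. Disj (R v w) (Q v w)))
        (Conj (subrel_fm R' sq) (Conj (subrel_fm E2 sq)
        (subrel_fm (\<lambda>v w. Conj (R v w) (sq v w)) R')))))))"

lemma eval_completion_fm:
  assumes "e 0 = length xs" "e (Suc 0) = length xs"
    and d: "denotes1 ws xs C C'" "denotes2 ws xs R R0" "denotes2 ws xs Q Q0" "denotes1 ws xs E1 E1'"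
      "denotes2 ws xs E2 E2'" "denotes1 ws xs A A'" "denotes2 ws xs B R'"
    and s: "C' \<subseteq> set xs" "R0 \<subseteq> set xs \<times> set xs" "E2' \<subseteq> set xs \<times> set xs" "A' \<subseteq> set xs"
      "R' \<subseteq> set xs \<times> set xs"
  shows "eval ws (completion_fm C R Q E1 E2 A B) e \<longleftrightarrow> completion C' R0 Q0 E1' E2' A' R'"
proof -
  note sq = denotes2_square[OF denotes1_Disj[OF d(6) d(4)]]
  have le: "R0 \<inter> (A' \<union> E1') \<times> (A' \<union> E1') \<subseteq> set xs \<times> set xs"
    using s(2) by blast
  show ?thesis
    unfolding completion_fm_def completion_def Let_def
    using eval_disjoint1_fm[OF assms(1,2) d(6) d(4) s(4)] eval_disjoint2_fm[OF assms(1,2) d(7) d(5) s(5)]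
      eval_subset_fm[OF assms(1,2) d(1) d(6) s(1)]
      eval_subrel_fm[OF assms(1,2) d(7) denotes2_Disj[OF d(2) d(3)] s(5)]
      eval_subrel_fm[OF assms(1,2) d(7) sq s(5)] eval_subrel_fm[OF assms(1,2) d(5) sq s(3)]
      eval_subrel_fm[OF assms(1,2) denotes2_Conj[OF d(2) sq] d(7) le]
    by simp
qed

section \<open>Recognising the words that encode instances\<close>

definition word ::
  "'a list \<Rightarrow> bool \<Rightarrow> 'a set \<Rightarrow> 'a set \<Rightarrow> 'a set \<Rightarrow> ('a \<times> 'a) set \<Rightarrow> ('a \<times> 'a) set \<Rightarrow> ('a \<times> 'a) set \<Rightarrow>
     bool list" where
  "word xs c C S E1 R Q E2 =
     replicate (length xs) True @ [False] @ [c] @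
     map (\<lambda>a. a \<in> C) xs @ map (\<lambda>a. a \<in> S) xs @ map (\<lambda>a. a \<in> E1) xs @
     map (\<lambda>r. r \<in> R) (List.product xs xs) @ map (\<lambda>r. r \<in> Q) (List.product xs xs) @
     map (\<lambda>r. r \<in> E2) (List.product xs xs)"

lemma encode_word:
  "encode xs I S act e =
     word xs (act = Addition) (cert_args I) S {a. e = Inl a} (cert_atts I) (unc_atts I) {r. e = Inr r}"
  by (simp add: encode_def word_def)

lemma length_word:
  "length (word xs c C S E1 R Q E2) = 2 + 4 * length xs + 3 * (length xs * length xs)"
  by (simp add: word_def)

lemma prefix_word [simp]: "prefix (word xs c C S E1 R Q E2) = length xs"
  by (simp add: word_def prefix_def takeWhile_append)

lemma symbol_eq_0: "symbol w i = 0 \<longleftrightarrow> length w \<le> i"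
  by (auto simp: symbol_def)

text \<open>The nonblank cells are contiguous from cell 0, so one nonblank cell followed by a blank
  one fixes the length. With \<open>n\<close> arguments it is \<open>n\<close> for the unary prefix,
  2 for separator and action, \<open>3 * n\<close> for the vectors and \<open>3 * (n * n)\<close>
  for the matrices.\<close>

definition length_fm :: fm where
  "length_fm = Conj (Neg (Sym 0 0 (pos 1 4 3 Zero))) (Sym 0 0 (pos 2 4 3 Zero))"

lemma eval_length_fm:
  assumes "e 0 = n" "e (Suc 0) = n"
  shows "eval ws length_fm e \<longleftrightarrow> length (ws ! 0) = 2 + 4 * n + 3 * (n * n)"
  using assms by (auto simp: length_fm_def symbol_eq_0)

lemma split_block:
  assumes "length z = a + r"
  obtains b z' where "z = b @ z'" "length b = a" "length z' = r"
  using assms that[of "take a z" "drop a z"] by simp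

text \<open>Once the length is right, no bit pattern is excluded: the first bit that is not true is
  the separator, the next one the action, and each remaining block is the characteristic vector of
  some set.\<close>

lemma word_ex:
  assumes len: "length x = 2 + 4 * prefix x + 3 * (prefix x * prefix x)"
    and xs: "distinct xs" "length xs = prefix x"
  obtains c C S E1 R Q E2 where "x = word xs c C S E1 R Q E2" "C \<subseteq> set xs" "S \<subseteq> set xs" "E1 \<subseteq> set xs"
    "R \<subseteq> set xs \<times> set xs" "Q \<subseteq> set xs \<times> set xs" "E2 \<subseteq> set xs \<times> set xs"
proof -
  define n d where "n = prefix x" and "d = dropWhile id x"
  have "takeWhile id x = replicate n True"
    by (rule replicate_eqI) (auto simp: n_def prefix_def dest: set_takeWhileD)
  then have x: "x = replicate n True @ d"
    using takeWhile_dropWhile_id[of id x] by (simp add: d_def)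
  have len': "length d = 2 + 3 * n + 3 * (n * n)"
    using len arg_cong[OF x, of length] unfolding n_def[symmetric] by simp
  have "d \<noteq> [] \<Longrightarrow> \<not> hd d"
    using hd_dropWhile[of id x] by (simp add: d_def)
  then obtain y where y: "d = False # y"
    using len' by (cases d) auto
  have "length y = Suc (3 * n + 3 * (n * n))"
    using len' y by simp
  then obtain c z where z: "y = c # z" "length z = n + (n + (n + (n * n + (n * n + n * n))))"
    by (cases y) auto
  obtain b1 z1 where b1: "z = b1 @ z1" "length b1 = n"
      "length z1 = n + (n + (n * n + (n * n + n * n)))"
    using z(2) by (rule split_block)
  obtain b2 z2 where b2: "z1 = b2 @ z2" "length b2 = n"
      "length z2 = n + (n * n + (n * n + n * n))"
    using b1(3) by (rule split_block)
  obtain b3 z3 where b3: "z2 = b3 @ z3" "length b3 = n" "length z3 = n * n + (n * n + n * n)"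
    using b2(3) by (rule split_block)
  obtain b4 z4 where b4: "z3 = b4 @ z4" "length b4 = n * n" "length z4 = n * n + n * n"
    using b3(3) by (rule split_block)
  obtain b5 b6 where b5: "z4 = b5 @ b6" "length b5 = n * n" "length b6 = n * n"
    using b4(3) by (rule split_block)
  have single: "\<exists>X \<subseteq> set xs. b = map (\<lambda>a. a \<in> X) xs" if "length b = n" for b
    using block_ex[OF xs(1), of b] that xs(2) by (simp add: n_def)
  have pair: "\<exists>Y \<subseteq> set xs \<times> set xs. b = map (\<lambda>a. a \<in> Y) (List.product xs xs)"
    if "length b = n * n" for b
    using block_ex[OF distinct_product[OF xs(1) xs(1)], of b] that xs(2) by (simp add: n_def)
  obtain C where C: "C \<subseteq> set xs" "b1 = map (\<lambda>a. a \<in> C) xs" using single[OF b1(2)] by blast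
  obtain S where S: "S \<subseteq> set xs" "b2 = map (\<lambda>a. a \<in> S) xs" using single[OF b2(2)] by blast
  obtain E1 where E1: "E1 \<subseteq> set xs" "b3 = map (\<lambda>a. a \<in> E1) xs" using single[OF b3(2)] by blast
  obtain R where R: "R \<subseteq> set xs \<times> set xs" "b4 = map (\<lambda>a. a \<in> R) (List.product xs xs)"
    using pair[OF b4(2)] by blast
  obtain Q where Q: "Q \<subseteq> set xs \<times> set xs" "b5 = map (\<lambda>a. a \<in> Q) (List.product xs xs)"
    using pair[OF b5(2)] by blast
  obtain E2 where E2: "E2 \<subseteq> set xs \<times> set xs" "b6 = map (\<lambda>a. a \<in> E2) (List.product xs xs)"
    using pair[OF b5(3)] by blast
  have "x = replicate n True @ [False] @ [c] @ b1 @ b2 @ b3 @ b4 @ b5 @ b6"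
    by (subst x) (simp add: y z(1) b1(1) b2(1) b3(1) b4(1) b5(1))
  then have "x = word xs c C S E1 R Q E2"
    unfolding word_def C(2) S(2) E1(2) R(2) Q(2) E2(2) xs(2) n_def .
  then show ?thesis
    using that C S E1 R Q E2 by blast
qed

text \<open>Formulas have no equality atom. On a word of the right length, the cell tested by
  \<open>reach_fm\<close> is blank iff the values of \<open>v\<close> and of variable 6 add up to at least
  the size of the universe, which suffices to compare two variables.\<close>

definition reach_fm :: "nat \<Rightarrow> fm" where
  "reach_fm v = Sym 0 0 (pos 2 3 3 (Plus (Times v One) (Times 6 One)))"

definition eq_fm :: "nat \<Rightarrow> nat \<Rightarrow> fm" where
  "eq_fm v w = All 6 (Conj (Imp (reach_fm v) (reach_fm w)) (Imp (reach_fm w) (reach_fm v)))"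

lemma eval_eq_fm:
  assumes "e 0 = n" "e (Suc 0) = n" "length (ws ! 0) = 2 + 4 * n + 3 * (n * n)"
    and "e v < n" "e w < n" "2 \<le> v" "v < 6" "2 \<le> w" "w < 6"
  shows "eval ws (eq_fm v w) e \<longleftrightarrow> e v = e w"
proof -
  have reach: "eval ws (reach_fm u) (e(6 := k)) \<longleftrightarrow> n \<le> e u + k" if "2 \<le> u" "u < 6" for u k
    using that assms by (auto simp: reach_fm_def symbol_eq_0)
  have "eval ws (eq_fm v w) e \<longleftrightarrow> (\<forall>k<n. n \<le> e v + k \<longleftrightarrow> n \<le> e w + k)"
    using assms by (auto simp: eq_fm_def reach)
  also have "\<dots> \<longleftrightarrow> e v = e w"
  proof
    assume *: "\<forall>k<n. n \<le> e v + k \<longleftrightarrow> n \<le> e w + k"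
    show "e v = e w"
    proof (rule ccontr)
      assume "e v \<noteq> e w"
      then consider "e v < e w" | "e w < e v"
        by linarith
      then show False
      proof cases
        \<comment> \<open>The witness is the least \<open>k\<close> that reaches the end together
          with the larger value; it is below \<open>n\<close> because the larger value is
          positive.\<close>
        case 1
        then show ?thesis
          using *[rule_format, of "n - e w"] assms by linarith
      next
        case 2
        then show ?thesis
          using *[rule_format, of "n - e v"] assms by linarith
      qed
    qed
  qed simp
  finally show ?thesis .
qed

text \<open>The conjuncts say that some element is marked, at most one argument, at most one attack,
  and not both kinds: the two blocks then describe a single element of the disjoint sum.\<close>

definition element_fm :: "(nat \<Rightarrow> fm) \<Rightarrow> (nat \<Rightarrow> nat \<Rightarrow> fm) \<Rightarrow> fm" where
  "element_fm E1 E2 =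
     Conj (Disj (Ex 2 (E1 2)) (Ex 2 (Ex 3 (E2 2 3))))
       (Conj (All 2 (All 3 (Imp (E1 2) (Imp (E1 3) (eq_fm 2 3)))))
       (Conj (All 2 (All 3 (All 4 (All 5
               (Imp (E2 2 3) (Imp (E2 4 5) (Conj (eq_fm 2 4) (eq_fm 3 5))))))))
         (All 2 (All 3 (All 4 (Imp (E1 2) (Neg (E2 3 4))))))))"

lemma eval_element_fm:
  assumes e: "e 0 = length xs" "e (Suc 0) = length xs"
    and len: "length (ws ! 0) = 2 + 4 * length xs + 3 * (length xs * length xs)"
    and d: "denotes1 ws xs E1 X" "denotes2 ws xs E2 Y"
    and s: "X \<subseteq> set xs" "Y \<subseteq> set xs \<times> set xs"
    and "distinct xs"
  shows "eval ws (element_fm E1 E2) e \<longleftrightarrow> (\<exists>z. X = {a. z = Inl a} \<and> Y = {r. z = Inr r})"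
proof -
  let ?ex = "\<not> ((\<forall>a\<in>set xs. a \<notin> X) \<and> (\<forall>a\<in>set xs. \<forall>b\<in>set xs. (a, b) \<notin> Y))"
  let ?u1 = "\<forall>a\<in>set xs. \<forall>b\<in>set xs. a \<in> X \<longrightarrow> b \<in> X \<longrightarrow> a = b"
  let ?u2 = "\<forall>a\<in>set xs. \<forall>b\<in>set xs. \<forall>c\<in>set xs. \<forall>d\<in>set xs.
      (a, b) \<in> Y \<longrightarrow> (c, d) \<in> Y \<longrightarrow> a = c \<and> b = d"
  let ?dis = "\<forall>a\<in>set xs. \<forall>b\<in>set xs. \<forall>c\<in>set xs. a \<in> X \<longrightarrow> (b, c) \<notin> Y"
  have nth_eq: "xs ! i = xs ! j \<longleftrightarrow> i = j" if "i < length xs" "j < length xs" for i j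
    using that assms by (simp add: nth_eq_iff_index_eq)
  note simps = all_set_conv_all_nth denotes1D[OF d(1)] denotes2D[OF d(2)]
    eval_eq_fm[where n = "length xs"] nth_eq
  have "eval ws (Disj (Ex 2 (E1 2)) (Ex 2 (Ex 3 (E2 2 3)))) e \<longleftrightarrow> ?ex"
    using e by (auto simp: simps)
  moreover have "eval ws (All 2 (All 3 (Imp (E1 2) (Imp (E1 3) (eq_fm 2 3))))) e \<longleftrightarrow> ?u1"
    using e len by (auto simp: simps)
  moreover have "eval ws (All 2 (All 3 (All 4 (All 5
      (Imp (E2 2 3) (Imp (E2 4 5) (Conj (eq_fm 2 4) (eq_fm 3 5)))))))) e \<longleftrightarrow> ?u2"
    using e len by (auto simp: simps)
  moreover have "eval ws (All 2 (All 3 (All 4 (Imp (E1 2) (Neg (E2 3 4)))))) e \<longleftrightarrow> ?dis"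
    unfolding all_set_conv_all_nth using e by (auto simp: simps)
  ultimately have "eval ws (element_fm E1 E2) e \<longleftrightarrow> ?ex \<and> ?u1 \<and> ?u2 \<and> ?dis"
    unfolding element_fm_def eval.simps(3) by (simp only:)
  also have "\<dots> \<longleftrightarrow> (\<exists>z. X = {a. z = Inl a} \<and> Y = {r. z = Inr r})"
  proof
    assume *: "?ex \<and> ?u1 \<and> ?u2 \<and> ?dis"
    note ex = *[THEN conjunct1]
      and u1 = *[THEN conjunct2, THEN conjunct1]
      and u2 = *[THEN conjunct2, THEN conjunct2, THEN conjunct1]
      and dis = *[THEN conjunct2, THEN conjunct2, THEN conjunct2]
    from ex consider a where "a \<in> X" | a b where "(a, b) \<in> Y"
      by blast
    then show "\<exists>z. X = {a. z = Inl a} \<and> Y = {r. z = Inr r}"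
    proof cases
      case 1
      have "b = a" if "b \<in> X" for b
        using u1[rule_format, of b a] 1 that s(1) by auto
      moreover have "r \<notin> Y" for r
        using dis[rule_format, of a "fst r" "snd r"] 1 s by (cases r) auto
      ultimately have "X = {a}" "Y = {}"
        using 1 by blast+
      then show ?thesis
        by (intro exI[of _ "Inl a"]) simp
    next
      case 2
      have "c \<notin> X" for c
        using dis[rule_format, of c a b] 2 s by auto
      moreover have "r = (a, b)" if "r \<in> Y" for r
        using u2[rule_format, of "fst r" "snd r" a b] 2 that s(2) by (cases r) auto
      ultimately have "X = {}" "Y = {(a, b)}"
        using 2 by blast+
      then show ?thesis
        by (intro exI[of _ "Inr (a, b)"]) simp
    qed
  next
    assume "\<exists>z. X = {a. z = Inl a} \<and> Y = {r. z = Inr r}"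
    then obtain z where z: "X = {a. z = Inl a}" "Y = {r. z = Inr r}"
      by blast
    show "?ex \<and> ?u1 \<and> ?u2 \<and> ?dis"
    proof (cases z)
      case (Inl a)
      then have "X = {a}" "Y = {}"
        using z by auto
      then show ?thesis
        using s by simp
    next
      case (Inr r)
      then have "X = {}" "Y = {r}"
        using z by auto
      then show ?thesis
        using s by (cases r) auto
    qed
  qed
  finally show ?thesis .
qed

section \<open>The relevance problem\<close>

definition valid_fm ::
  "(nat \<Rightarrow> fm) \<Rightarrow> (nat \<Rightarrow> fm) \<Rightarrow> (nat \<Rightarrow> nat \<Rightarrow> fm) \<Rightarrow> (nat \<Rightarrow> nat \<Rightarrow> fm) \<Rightarrow> (nat \<Rightarrow> nat \<Rightarrow> fm) \<Rightarrow> fm" where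
  "valid_fm C E1 R Q E2 =
     Conj (element_fm E1 E2) (Conj (disjoint1_fm E1 C) (Conj (subrel_fm E2 Q) (disjoint2_fm R Q)))"

text \<open>Together with the length test this singles out the encodings. Uncertain arguments have
  no block of their own: they are the complement of \<open>C\<close>, so an uncertain argument
  \<open>e\<close> amounts to \<open>E1 \<inter> C = {}\<close>. The shape of the matrices keeps
  attacks within the universe.\<close>

definition valid ::
  "'a set \<Rightarrow> 'a set \<Rightarrow> ('a \<times> 'a) set \<Rightarrow> ('a \<times> 'a) set \<Rightarrow> ('a \<times> 'a) set \<Rightarrow> bool" where
  "valid C E1 R Q E2 \<longleftrightarrow>
     (\<exists>e. E1 = {a. e = Inl a} \<and> E2 = {r. e = Inr r}) \<and> E1 \<inter> C = {} \<and> E2 \<subseteq> Q \<and> R \<inter> Q = {}"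

text \<open>The sets of an instance are read from tape 0 with the layout of \<^const>\<open>encode\<close>. Tape 1 holds
  the existential certificate: the completion \<open>(A', R')\<close>, the set \<open>T\<close> of
  \<^const>\<open>check_out\<close> and the order of \<^const>\<open>check_in\<close>; tape 2 holds the universally
  quantified set of \<^const>\<open>check_in\<close>.\<close>

abbreviation "fC \<equiv> unary 0 2 1 0"
abbreviation "fS \<equiv> unary 0 2 2 0"
abbreviation "fE1 \<equiv> unary 0 2 3 0"
abbreviation "fR \<equiv> binary 0 2 4 0"
abbreviation "fQ \<equiv> binary 0 2 4 1"
abbreviation "fE2 \<equiv> binary 0 2 4 2"
abbreviation "fA \<equiv> unary 1 0 0 0"
abbreviation "fB \<equiv> binary 1 0 1 0"
abbreviation "fT \<equiv> unary 1 0 1 1"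
abbreviation "fL \<equiv> binary 1 0 2 1"
abbreviation "fV \<equiv> unary 2 0 0 0"

abbreviation "args_with \<equiv> (\<lambda>v. Disj (fA v) (fE1 v))"
abbreviation "atts_with \<equiv>
  (\<lambda>v w. Conj (Disj (fB v w) (fE2 v w)) (Conj (args_with v) (args_with w)))"
abbreviation "atts_without \<equiv> (\<lambda>v w. Conj (fB v w) (Conj (fA v) (fA w)))"

text \<open>The cell at \<open>n + 1\<close> holds the action bit, and \<open>add\<close> says that
  it agrees with \<open>b\<close>; this is the case distinction of
  \<open>relevant_iff\<close>.\<close>

definition status_fm :: "semantics \<Rightarrow> bool \<Rightarrow> fm" where
  "status_fm j b =
     (let add = (if b then Sym 0 2 (pos 1 1 0 Zero) else Neg (Sym 0 2 (pos 1 1 0 Zero)))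
      in Disj
        (Conj add (Conj (in_fm j args_with atts_with fS fL fV) (out_fm j fA atts_without fS fT)))
        (Conj (Neg add) (Conj (in_fm j fA atts_without fS fL fV) (out_fm j args_with atts_with fS fT))))"

definition relevance_fm :: "semantics \<Rightarrow> bool \<Rightarrow> fm" where
  "relevance_fm j b =
     Conj length_fm (Conj (valid_fm fC fE1 fR fQ fE2) (Conj (completion_fm fC fR fQ fE1 fE2 fA fB)
       (status_fm j b)))"

lemmas fm_defs = relevance_fm_def status_fm_def length_fm_def valid_fm_def element_fm_def eq_fm_def
  reach_fm_def disjoint1_fm_def disjoint2_fm_def completion_fm_def subset_fm_def subrel_fm_def
  conflict_free_fm_def defends_fm_def admissible_fm_def complete_fm_def stable_fm_def order_fm_def
  psubset_fm_def

text \<open>This is where the two classes part: \<open>fV\<close> is the only atom on tape 2, and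
  among the semantics only \<open>PR\<close> mentions it.\<close>

lemma wf_relevance_fm: "wf_fm 3 (relevance_fm j b)" "j \<noteq> PR \<Longrightarrow> wf_fm 2 (relevance_fm j b)"
  by (cases j; simp add: fm_defs Let_def)+

lemma denotes_word:
  assumes "ws ! 0 = word xs c C S E1 R Q E2"
  shows "denotes1 ws xs fC C" "denotes1 ws xs fS S" "denotes1 ws xs fE1 E1"
    "denotes2 ws xs fR R" "denotes2 ws xs fQ Q" "denotes2 ws xs fE2 E2"
proof -
  let ?p = "replicate (length xs) True @ [False, c]"
  let ?u = "\<lambda>X. map (\<lambda>a. a \<in> X) xs" and ?b = "\<lambda>Y. map (\<lambda>r. r \<in> Y) (List.product xs xs)"
  show "denotes1 ws xs fC C"
    by (rule denotes_unary[of _ _ ?p]) (simp_all add: assms word_def)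
  show "denotes1 ws xs fS S"
    by (rule denotes_unary[of _ _ "?p @ ?u C"]) (simp_all add: assms word_def)
  show "denotes1 ws xs fE1 E1"
    by (rule denotes_unary[of _ _ "?p @ ?u C @ ?u S" _ _ "?b R @ ?b Q @ ?b E2"])
      (simp_all add: assms word_def)
  show "denotes2 ws xs fR R"
    by (rule denotes_binary[of _ _ "?p @ ?u C @ ?u S @ ?u E1"]) (simp_all add: assms word_def)
  show "denotes2 ws xs fQ Q"
    by (rule denotes_binary[of _ _ "?p @ ?u C @ ?u S @ ?u E1 @ ?b R"]) (simp_all add: assms word_def)
  show "denotes2 ws xs fE2 E2"
    by (rule denotes_binary[of _ _ "?p @ ?u C @ ?u S @ ?u E1 @ ?b R @ ?b Q" _ _ "[]"])
      (simp_all add: assms word_def)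
qed

lemma symbol_action: "symbol (word xs c C S E1 R Q E2) (Suc (length xs)) = 2 \<longleftrightarrow> c"
  by (simp add: symbol_def word_def nth_append)

lemma eval_relevance_fm:
  assumes xs: "distinct xs" and w: "ws ! 0 = word xs c C S E1 R Q E2"
    and sub: "C \<subseteq> set xs" "S \<subseteq> set xs" "E1 \<subseteq> set xs"
      "R \<subseteq> set xs \<times> set xs" "Q \<subseteq> set xs \<times> set xs" "E2 \<subseteq> set xs \<times> set xs"
    and d: "denotes1 ws xs fA A'" "denotes2 ws xs fB R'" "denotes1 ws xs fT T" "denotes2 ws xs fL L"
      "denotes1 ws xs fV V"
    and sub': "A' \<subseteq> set xs" "R' \<subseteq> set xs \<times> set xs" "T \<subseteq> set xs" "L \<subseteq> set xs \<times> set xs" "V \<subseteq> set xs"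
  shows "eval ws (relevance_fm j b) (sizes (length xs)) \<longleftrightarrow>
    valid C E1 R Q E2 \<and> completion C R Q E1 E2 A' R' \<and>
    (if c = b
     then check_in j (with_element A' R' E1 E2) S L V \<and> check_out j (without_element A' R') S T
     else check_in j (without_element A' R') S L V \<and> check_out j (with_element A' R' E1 E2) S T)"
proof -
  let ?e = "sizes (length xs)"
  let ?W = "with_element A' R' E1 E2" and ?O = "without_element A' R'"
  have e: "?e 0 = length xs" "?e (Suc 0) = length xs"
    by (simp_all add: sizes_def)
  have len: "length (ws ! 0) = 2 + 4 * length xs + 3 * (length xs * length xs)"
    by (simp add: w length_word)
  note dw = denotes_word[OF w]
  have args_W: "denotes1 ws xs args_with (args ?W)"
    using denotes1_Disj[OF d(1) dw(3)] by (simp add: with_element_def)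
  have atts_W: "denotes2 ws xs atts_with (atts ?W)"
    using denotes2_Conj[OF denotes2_Disj[OF d(2) dw(6)] denotes2_square[OF args_W]]
    by (simp add: with_element_def)
  have args_O: "denotes1 ws xs fA (args ?O)"
    using d(1) by (simp add: without_element_def)
  have atts_O: "denotes2 ws xs atts_without (atts ?O)"
    using denotes2_Conj[OF d(2) denotes2_square[OF args_O]] by (simp add: without_element_def)
  have W: "args ?W \<subseteq> set xs" "atts ?W \<subseteq> set xs \<times> set xs"
    using sub sub' by (auto simp: with_element_def)
  have O: "args ?O \<subseteq> set xs" "atts ?O \<subseteq> set xs \<times> set xs"
    using sub sub' by (auto simp: without_element_def)
  have 1: "eval ws length_fm ?e"
    using eval_length_fm[OF e] len by blast
  have 2: "eval ws (valid_fm fC fE1 fR fQ fE2) ?e \<longleftrightarrow> valid C E1 R Q E2"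
    unfolding valid_fm_def valid_def eval.simps(3)
      eval_element_fm[OF e len dw(3) dw(6) sub(3) sub(6) xs]
      eval_disjoint1_fm[OF e dw(3) dw(1) sub(3)] eval_subrel_fm[OF e dw(6) dw(5) sub(6)]
      eval_disjoint2_fm[OF e dw(4) dw(5) sub(4)] ..
  note 3 = eval_completion_fm[OF e dw(1) dw(4) dw(5) dw(3) dw(6) d(1) d(2) sub(1) sub(4) sub(6) sub'(1,2)]
  have act: "eval ws (Sym 0 2 (pos 1 1 0 Zero)) ?e \<longleftrightarrow> c"
    using symbol_action[of xs c C S E1 R Q E2] by (simp add: w e)
  have 4: "eval ws (status_fm j b) ?e \<longleftrightarrow>
     (if c = b then check_in j ?W S L V \<and> check_out j ?O S T
      else check_in j ?O S L V \<and> check_out j ?W S T)"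
    using act eval_in_fm[OF e args_W atts_W dw(2) d(4) d(5) sub(2) W sub'(4,5), of j]
      eval_in_fm[OF e args_O atts_O dw(2) d(4) d(5) sub(2) O sub'(4,5), of j]
      eval_out_fm[OF e args_W atts_W dw(2) d(3) sub(2) W sub'(3), of j]
      eval_out_fm[OF e args_O atts_O dw(2) d(3) sub(2) O sub'(3), of j]
    unfolding status_fm_def Let_def by (cases b) (auto simp del: eval.simps(1))
  show ?thesis
    unfolding relevance_fm_def eval.simps(3) 2 3 4 using 1 by simp
qed

text \<open>Certificates and tuples of sets correspond in both directions: any word decodes to sets,
  and any sets are written as concatenated blocks. Keeping \<open>xs\<close> arbitrary makes the
  result applicable to every enumeration of the arguments.\<close>

lemma certificate_iff:
  assumes xs: "distinct xs" and w: "x = word xs c C S E1 R Q E2"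
    and sub: "C \<subseteq> set xs" "S \<subseteq> set xs" "E1 \<subseteq> set xs"
      "R \<subseteq> set xs \<times> set xs" "Q \<subseteq> set xs \<times> set xs" "E2 \<subseteq> set xs \<times> set xs"
  shows "(\<exists>u. length u \<le> length x \<and> (\<forall>v. length v \<le> length x \<longrightarrow>
       eval [x, u, v] (relevance_fm j b) (sizes (length xs)))) \<longleftrightarrow>
    valid C E1 R Q E2 \<and> (\<exists>A' R'. A' \<subseteq> set xs \<and> completion C R Q E1 E2 A' R' \<and>
      (if c = b
       then S \<in> extensions j (with_element A' R' E1 E2) \<and> S \<notin> extensions j (without_element A' R')
       else S \<in> extensions j (without_element A' R') \<and> S \<notin> extensions j (with_element A' R' E1 E2)))"
    (is "?L \<longleftrightarrow> ?valid \<and> (\<exists>A' R'. A' \<subseteq> set xs \<and> ?comp A' R' \<and> ?ext A' R')")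
proof -
  let ?W = "\<lambda>A' R'. with_element A' R' E1 E2"
  define chk where "chk A' R' T L V \<longleftrightarrow>
    (if c = b then check_in j (?W A' R') S L V \<and> check_out j (without_element A' R') S T
     else check_in j (without_element A' R') S L V \<and> check_out j (?W A' R') S T)" for A' R' T L V
  have ext: "?ext A' R' \<longleftrightarrow> (\<exists>T L. T \<subseteq> set xs \<and> L \<subseteq> set xs \<times> set xs \<and> (\<forall>V \<subseteq> set xs. chk A' R' T L V))"
    if "A' \<subseteq> set xs" for A' R'
  proof -
    have W: "args (?W A' R') \<subseteq> set xs" "atts (?W A' R') \<subseteq> set xs \<times> set xs"
      using that sub by (auto simp: with_element_def)
    have O: "args (without_element A' R') \<subseteq> set xs" "atts (without_element A' R') \<subseteq> set xs \<times> set xs"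
      using that by (auto simp: without_element_def)
    \<comment> \<open>Moving \<open>Q T\<close> under the universal quantifier is reversible because
      the range of \<open>V\<close> contains the empty set.\<close>
    have merge: "(\<exists>L \<subseteq> set xs \<times> set xs. \<forall>V \<subseteq> set xs. P L V) \<and> (\<exists>T \<subseteq> set xs. Q T) \<longleftrightarrow>
        (\<exists>T L. T \<subseteq> set xs \<and> L \<subseteq> set xs \<times> set xs \<and> (\<forall>V \<subseteq> set xs. P L V \<and> Q T))"
      for P :: "('a \<times> 'a) set \<Rightarrow> 'a set \<Rightarrow> bool" and Q :: "'a set \<Rightarrow> bool"
      by (meson empty_subsetI)
    show ?thesis
      unfolding chk_def extensions_check_out[OF W(1)] extensions_check_out[OF O(1)]
      unfolding extensions_check_in[OF finite_set W sub(2)] extensions_check_in[OF finite_set O sub(2)]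
      by (cases "c = b") (simp_all only: refl if_True if_False merge)
  qed
  have ev: "eval [x, u, v] (relevance_fm j b) (sizes (length xs)) \<longleftrightarrow>
      ?valid \<and> ?comp A' R' \<and> chk A' R' T L V"
    if "denotes1 [x, u, v] xs fA A'" "denotes2 [x, u, v] xs fB R'" "denotes1 [x, u, v] xs fT T"
      "denotes2 [x, u, v] xs fL L" "denotes1 [x, u, v] xs fV V"
      "A' \<subseteq> set xs" "R' \<subseteq> set xs \<times> set xs" "T \<subseteq> set xs" "L \<subseteq> set xs \<times> set xs" "V \<subseteq> set xs"
    for u v A' R' T L V
    unfolding chk_def by (rule eval_relevance_fm[OF xs]) (use w sub that in simp_all)
  have len: "length x = 2 + 4 * length xs + 3 * (length xs * length xs)"
    unfolding w by (rule length_word)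
  have V: "denotes1 [x, u, map (\<lambda>a. a \<in> V) xs] xs fV V" for u V
    by (rule denotes_unary[of _ _ "[]" _ _ "[]"]) simp_all
  show ?thesis
  proof
    assume ?L
    then obtain u where u: "\<And>v. length v \<le> length x \<Longrightarrow>
        eval [x, u, v] (relevance_fm j b) (sizes (length xs))"
      by blast
    obtain A' where A': "A' \<subseteq> set xs" "\<forall>ws. ws ! 1 = u \<longrightarrow> denotes1 ws xs fA A'"
      using denotes_unary_ex[OF xs, of 1 u 0 0 0] by blast
    obtain R' where R': "R' \<subseteq> set xs \<times> set xs" "\<forall>ws. ws ! 1 = u \<longrightarrow> denotes2 ws xs fB R'"
      using denotes_binary_ex[OF xs, of 1 u 0 1 0] by blast
    obtain T where T: "T \<subseteq> set xs" "\<forall>ws. ws ! 1 = u \<longrightarrow> denotes1 ws xs fT T"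
      using denotes_unary_ex[OF xs, of 1 u 0 1 1] by blast
    obtain L where L: "L \<subseteq> set xs \<times> set xs" "\<forall>ws. ws ! 1 = u \<longrightarrow> denotes2 ws xs fL L"
      using denotes_binary_ex[OF xs, of 1 u 0 2 1] by blast
    have *: "?valid \<and> ?comp A' R' \<and> chk A' R' T L V" if "V \<subseteq> set xs" for V
    proof -
      let ?v = "map (\<lambda>a. a \<in> V) xs"
      have "eval [x, u, ?v] (relevance_fm j b) (sizes (length xs)) \<longleftrightarrow>
          ?valid \<and> ?comp A' R' \<and> chk A' R' T L V"
        by (rule ev) (use A' R' T L V that in simp_all)
      then show ?thesis
        using u[of ?v] by (simp add: len)
    qed
    have "?ext A' R'"
      unfolding ext[OF A'(1)] using * T(1) L(1) by (intro exI[of _ T] exI[of _ L]) simp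
    then show "?valid \<and> (\<exists>A' R'. A' \<subseteq> set xs \<and> ?comp A' R' \<and> ?ext A' R')"
      \<comment> \<open>Validity and the completion condition do not depend on \<open>V\<close>, so
        the instance with \<open>V\<close> empty yields them.\<close>
      using *[OF empty_subsetI] A'(1) by (intro conjI exI[of _ A'] exI[of _ R']) (elim conjE, assumption)+
  next
    assume "?valid \<and> (\<exists>A' R'. A' \<subseteq> set xs \<and> ?comp A' R' \<and> ?ext A' R')"
    then obtain A' R' where val: ?valid and A': "A' \<subseteq> set xs" and comp: "?comp A' R'"
      and ext': "?ext A' R'"
      by (elim conjE exE) (rule that)
    obtain T L where T: "T \<subseteq> set xs" and L: "L \<subseteq> set xs \<times> set xs"
      and chk: "\<forall>V \<subseteq> set xs. chk A' R' T L V"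
      using ext'[unfolded ext[OF A']] by (elim conjE exE) (rule that)
    have "R' \<subseteq> R \<union> Q"
      using comp by (simp only: completion_def)
    then have R': "R' \<subseteq> set xs \<times> set xs"
      using sub(4,5) by (meson Un_least subset_trans)
    let ?s = "\<lambda>X. map (\<lambda>a. a \<in> X) xs" and ?p = "\<lambda>Y. map (\<lambda>r. r \<in> Y) (List.product xs xs)"
    define u where "u = ?s A' @ ?p R' @ ?s T @ ?p L"
    \<comment> \<open>Here \<open>v\<close> is an arbitrary word, so it is decoded to whatever set
      it denotes rather than assumed to be a characteristic vector.\<close>
    have "eval [x, u, v] (relevance_fm j b) (sizes (length xs))" for v
    proof -
      obtain V where V: "V \<subseteq> set xs" "\<forall>ws. ws ! 2 = v \<longrightarrow> denotes1 ws xs fV V"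
        using denotes_unary_ex[OF xs, of 2 v 0 0 0] by blast
      have "denotes1 [x, u, v] xs fA A'"
        by (rule denotes_unary[of _ _ "[]"]) (simp_all add: u_def)
      moreover have "denotes2 [x, u, v] xs fB R'"
        by (rule denotes_binary[of _ _ "?s A'"]) (simp_all add: u_def)
      moreover have "denotes1 [x, u, v] xs fT T"
        by (rule denotes_unary[of _ _ "?s A' @ ?p R'"]) (simp_all add: u_def)
      moreover have "denotes2 [x, u, v] xs fL L"
        by (rule denotes_binary[of _ _ "?s A' @ ?p R' @ ?s T" _ _ "[]"]) (simp_all add: u_def)
      moreover have "denotes1 [x, u, v] xs fV V"
        using V(2) by simp
      ultimately have "eval [x, u, v] (relevance_fm j b) (sizes (length xs)) \<longleftrightarrow>
          ?valid \<and> ?comp A' R' \<and> chk A' R' T L V"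
        by (rule ev) (fact A' R' T L V(1))+
      moreover have "chk A' R' T L V"
        using chk V(1) by blast
      ultimately show ?thesis
        using val comp by (simp only:)
    qed
    \<comment> \<open>Two vectors and two matrices take \<open>2 * n + 2 * (n * n)\<close> bits,
      less than the word itself, so the identity polynomial bounds the certificates.\<close>
    moreover have "length u \<le> length x"
      by (simp add: u_def len)
    ultimately show ?L
      by (intro exI[of _ u]) simp
  qed
qed

text \<open>No invariance under renaming is needed: an encoded instance is treated with its own
  enumeration, and an accepted word is shown to encode an instance built directly on an initial
  segment of the naturals.\<close>

lemma RELEVANCE_iff:
  "x \<in> RELEVANCE (j, b) \<longleftrightarrow>
     (\<exists>u. length u \<le> length x \<and> (\<forall>v. length v \<le> length x \<longrightarrow>
        eval [x, u, v] (relevance_fm j b) (sizes (prefix x))))"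
    (is "_ \<longleftrightarrow> ?R")
proof
  assume "x \<in> RELEVANCE (j, b)"
  then obtain xs :: "nat list" and I S act e where x: "x = encode xs I S act e"
    and I: "is_iaf I" and xs: "distinct xs" "set xs = cert_args I \<union> unc_args I"
    and S: "S \<subseteq> cert_args I \<union> unc_args I" and e: "e \<in> uncertain I" and rel: "relevant (j, b) act e S I"
    unfolding RELEVANCE_def by blast
  let ?E1 = "{a. e = Inl a}" and ?E2 = "{r. e = Inr r}"
  have w: "x = word xs (act = Addition) (cert_args I) S ?E1 (cert_atts I) (unc_atts I) ?E2"
    using x encode_word by metis
  have E: "?E1 \<subseteq> unc_args I" "?E2 \<subseteq> unc_atts I"
    using e by (auto simp: uncertain_def)
  have sub: "cert_args I \<subseteq> set xs" "S \<subseteq> set xs" "?E1 \<subseteq> set xs" "cert_atts I \<subseteq> set xs \<times> set xs"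
      "unc_atts I \<subseteq> set xs \<times> set xs" "?E2 \<subseteq> set xs \<times> set xs"
    using I E S by (auto simp: xs(2) is_iaf_def)
  have "valid (cert_args I) ?E1 (cert_atts I) (unc_atts I) ?E2"
    unfolding valid_def using I E by (intro conjI exI[of _ e]) (auto simp: is_iaf_def)
  moreover note rel[unfolded relevant_iff[OF e refl refl]]
  ultimately show ?R
    using certificate_iff[OF xs(1) w sub, of j b] w unfolding xs(2) by simp
next
  assume R: ?R
  define xs where "xs = [0..<prefix x]"
  have xs: "distinct xs" "length xs = prefix x"
    by (simp_all add: xs_def)
  have "eval [x, u, v] length_fm (sizes (prefix x))"
    if "eval [x, u, v] (relevance_fm j b) (sizes (prefix x))" for u v
    using that by (simp add: relevance_fm_def)
  then have "length x = 2 + 4 * prefix x + 3 * (prefix x * prefix x)"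
    using R eval_length_fm[of "sizes (prefix x)" "prefix x"] by (auto simp: sizes_def)
  then obtain c C S E1 R Q E2 where w: "x = word xs c C S E1 R Q E2"
    and sub: "C \<subseteq> set xs" "S \<subseteq> set xs" "E1 \<subseteq> set xs"
      "R \<subseteq> set xs \<times> set xs" "Q \<subseteq> set xs \<times> set xs" "E2 \<subseteq> set xs \<times> set xs"
    using xs by (rule word_ex)
  note cert = certificate_iff[OF xs(1) w sub, of j b, unfolded xs(2), THEN iffD1, OF \<open>?R\<close>]
  obtain e where e: "E1 = {a. e = Inl a}" "E2 = {r. e = Inr r}"
    and val: "E1 \<inter> C = {}" "E2 \<subseteq> Q" "R \<inter> Q = {}"
    using cert unfolding valid_def by blast
  \<comment> \<open>The word does not list the uncertain arguments, so all arguments outside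
    \<open>C\<close> are declared uncertain; validity then makes \<open>e\<close> an uncertain
    element.\<close>
  define I where "I = \<lparr>cert_args = C, unc_args = set xs - C, cert_atts = R, unc_atts = Q\<rparr>"
  define act where "act = (if c then Addition else Removal)"
  have U: "cert_args I \<union> unc_args I = set xs"
    using sub by (auto simp: I_def)
  have "is_iaf I"
    unfolding is_iaf_def U using sub val by (auto simp: I_def)
  moreover have unc: "e \<in> uncertain I"
    using val sub e by (cases e) (auto simp: I_def uncertain_def)
  moreover have "(act = Addition) = c"
    by (simp add: act_def)
  then have "relevant (j, b) act e S I"
    unfolding relevant_iff[OF unc e] U using cert[THEN conjunct2] by (simp add: I_def)
  moreover have "x = encode xs I S act e"
    unfolding w encode_word e by (simp add: I_def act_def)
  ultimately show "x \<in> RELEVANCE (j, b)"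
    unfolding RELEVANCE_def using xs(1) U sub(2) by blast
qed

theorem corollary1:
  shows "(\<forall>j \<in> {AD, ST, CO, GR} \<times> {True, False}. RELEVANCE j \<in> NP) \<and>
    RELEVANCE (PR, True) \<in> Sigma2P \<and> RELEVANCE (PR, False) \<in> Sigma2P"
proof -
  have "RELEVANCE (j, b) \<in> NP" if j: "j \<noteq> PR" for j b
  proof (rule NP_I[OF wf_relevance_fm(2)[OF j, of b]])
    fix x
    have "eval [x, u, v] (relevance_fm j b) e = eval [x, u] (relevance_fm j b) e" for u v e
      by (rule eval_cong[OF wf_relevance_fm(2)[OF j]]) (auto simp: less_Suc_eq numeral_2_eq_2)
    then show "x \<in> RELEVANCE (j, b) \<longleftrightarrow>
        (\<exists>u. length u \<le> length x \<and> eval [x, u] (relevance_fm j b) (sizes (prefix x)))"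
      unfolding RELEVANCE_iff by (metis list.size(3) zero_le)
  qed
  moreover have "RELEVANCE (PR, b) \<in> Sigma2P" for b
    by (rule Sigma2P_I[OF wf_relevance_fm(1)[of PR b] RELEVANCE_iff])
  ultimately show ?thesis
    by auto
qed

end
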